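(* Let $\{\mathcal{D}_l\}_{l\ge1}$ be a real-valued, centered, stationary and ergodic noise process such that: (1) for all $n$, $D^n=(\mathcal{D}_1,\ldots,\mathcal{D}_n)$ has a density $f^n$ on $\mathbb{R}^n$; (2) for all $n$ the differential entropy $h(D^n)$ is well defined; (3) the differential entropy rate $h(\mathcal{D})=\lim_{n}\frac1n h(D^n)$ exists and is finite; (4) the laws $\rho^n_{\mathcal{D}}$ of the random variables $-\frac1n\ln f^n(D^n)$ satisfy a large deviation principle on $\mathbb{R}$ (speed $n$) with a good and convex rate function $I$. Let $\alpha>1$ and, for every $n$, let $\mu^n$ be a homogeneous Poisson point process on $\mathbb{R}^n$ with intensity $\lambda_n=e^{n(-h(\mathcal{D})-\ln\alpha)}$, and let decoding be maximum likelihood (MLE) for $f^n$. Let $p_e(n)$ be the associated probability of error and $\underline{\pi}(\mathrm{Poi},\mathcal{L}(\mathcal{D}),\alpha,\mathcal{D})=\liminf_{n\to\infty}-\frac1n\ln p_e(n)$. Then $$\underline{\pi}(\mathrm{Poi},\mathcal{L}(\mathcal{D}),\alpha,\mathcal{D})\ \ge\ \inf_{u\in\mathbb{R}}\{F(u)+I(u)\},$$ where $$F(u)=\bigl(\ln\alpha+h(\mathcal{D})-J(u)\bigr)^+,\qquad J(u)=\sup_{s\le u}(s-I(s)).$$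
   Context: All logarithms are natural; $a^+=\max(a,0)$; values $\pm\infty$ are allowed for $I,J,F$. Write $\mu^n=\sum_k\epsilon_{T_k^n}$; $\mathbb{P}_0^n$ is its Palm probability ($T_0^n=0$). Each point carries a displacement vector $D_k^n$, i.i.d. in $k$ with the law of $D^n$ and independent of $\mu^n$. For $s,t\in\mathbb{R}^n$ let $\mathbb{D}(s,t)=-\frac1n\ln f^n(s-t)$. MLE decoding: the decoding region $\mathcal{L}_k^n(\mathcal{D})$ of $T_k^n$ consists of those $x\in\mathbb{R}^n$ with $\mathbb{D}(x,T_k^n)<\inf_{l\ne k}\mathbb{D}(x,T_l^n)$, together with those ambiguous locations $x$ (for which no point of $\mu^n$ is such a strict minimizer) that lie in the Euclidean Voronoi cell of $T_k^n$ with respect to $\mu^n$. The probability of error is $p_e(n)=\mathbb{P}_0^n(D_0^n\notin\mathcal{L}_0^n(\mathcal{D}))$. A good rate function is a lower semicontinuous $[0,\infty]$-valued function with compact sublevel sets. *)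

theory Defs
  imports "HOL-Probability.Probability"
begin

section \<open>Euclidean space of varying dimension\<close>

text \<open>The dimension \<open>n\<close> varies within the theorem, so \<open>\<real>\<^sup>n\<close> is the product Lebesgue space whose
  points are the functions \<open>nat \<Rightarrow> real\<close> that are \<open>undefined\<close> outside \<open>{1..n}\<close>.\<close>

abbreviation Rn :: "nat \<Rightarrow> (nat \<Rightarrow> real) measure" where
  "Rn n \<equiv> Pi\<^sub>M {1..n} (\<lambda>_. lborel)"

definition vorigin :: "nat \<Rightarrow> nat \<Rightarrow> real" where
  "vorigin n = (\<lambda>i\<in>{1..n}. 0)"

definition vdiff :: "nat \<Rightarrow> (nat \<Rightarrow> real) \<Rightarrow> (nat \<Rightarrow> real) \<Rightarrow> (nat \<Rightarrow> real)" where
  "vdiff n s t = (\<lambda>i\<in>{1..n}. s i - t i)"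

definition edist :: "nat \<Rightarrow> (nat \<Rightarrow> real) \<Rightarrow> (nat \<Rightarrow> real) \<Rightarrow> real" where
  "edist n s t = L2_set (\<lambda>i. s i - t i) {1..n}"

definition unit_cube :: "nat \<Rightarrow> (nat \<Rightarrow> real) set" where
  "unit_cube n = (\<Pi>\<^sub>E i\<in>{1..n}. {0..<1})"

section \<open>Large deviations\<close>

definition eln :: "ennreal \<Rightarrow> ereal" where
  "eln p = (if p = 0 then - \<infinity> else if p = \<infinity> then \<infinity> else ereal (ln (enn2real p)))"

definition good_rate_function :: "(real \<Rightarrow> ereal) \<Rightarrow> bool" where
  "good_rate_function I \<longleftrightarrow>
     (\<forall>s. 0 \<le> I s) \<and>
     (\<forall>s. I s \<le> Liminf (at s) I) \<and>
     (\<forall>c::real. compact {s. I s \<le> ereal c})"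

text \<open>In \<open>ereal\<close>, \<open>0 * \<infinity> = 0\<close>, so the inequality is trivial at \<open>t = 0\<close> and \<open>t = 1\<close>.\<close>

definition convex_ereal :: "(real \<Rightarrow> ereal) \<Rightarrow> bool" where
  "convex_ereal I \<longleftrightarrow>
     (\<forall>x y. \<forall>t\<in>{0..1}. I ((1 - t) * x + t * y) \<le> ereal (1 - t) * I x + ereal t * I y)"

definition LDP :: "(nat \<Rightarrow> real measure) \<Rightarrow> (real \<Rightarrow> ereal) \<Rightarrow> bool" where
  "LDP \<rho> I \<longleftrightarrow>
     (\<forall>C. closed C \<longrightarrow>
        limsup (\<lambda>n. eln (emeasure (\<rho> n) C) / ereal (real n)) \<le> - (INF s\<in>C. I s)) \<and>
     (\<forall>G. open G \<longrightarrow>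
        - (INF s\<in>G. I s) \<le> liminf (\<lambda>n. eln (emeasure (\<rho> n) G) / ereal (real n)))"

section \<open>The noise process\<close>

abbreviation path_space :: "(nat \<Rightarrow> real) measure" where
  "path_space \<equiv> Pi\<^sub>M {1..} (\<lambda>_. borel)"

definition path_shift :: "(nat \<Rightarrow> real) \<Rightarrow> (nat \<Rightarrow> real)" where
  "path_shift x = (\<lambda>l\<in>{1..}. x (Suc l))"

definition path_law :: "'v measure \<Rightarrow> (nat \<Rightarrow> 'v \<Rightarrow> real) \<Rightarrow> (nat \<Rightarrow> real) measure" where
  "path_law N X = distr N path_space (\<lambda>\<omega>. \<lambda>l\<in>{1..}. X l \<omega>)"

definition stationary_process :: "'v measure \<Rightarrow> (nat \<Rightarrow> 'v \<Rightarrow> real) \<Rightarrow> bool" where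
  "stationary_process N X \<longleftrightarrow> distr (path_law N X) path_space path_shift = path_law N X"

definition ergodic_process :: "'v measure \<Rightarrow> (nat \<Rightarrow> 'v \<Rightarrow> real) \<Rightarrow> bool" where
  "ergodic_process N X \<longleftrightarrow>
     (\<forall>A\<in>sets path_space. path_shift -` A \<inter> space path_space = A \<longrightarrow>
        measure (path_law N X) A \<in> {0, 1})"

definition centered_process :: "'v measure \<Rightarrow> (nat \<Rightarrow> 'v \<Rightarrow> real) \<Rightarrow> bool" where
  "centered_process N X \<longleftrightarrow>
     (\<forall>l\<ge>1. integrable N (X l) \<and> integral\<^sup>L N (X l) = 0)"

definition noise_vec :: "(nat \<Rightarrow> 'v \<Rightarrow> real) \<Rightarrow> nat \<Rightarrow> 'v \<Rightarrow> (nat \<Rightarrow> real)" where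
  "noise_vec X n \<omega> = (\<lambda>l\<in>{1..n}. X l \<omega>)"

definition has_density :: "'v measure \<Rightarrow> (nat \<Rightarrow> 'v \<Rightarrow> real) \<Rightarrow> nat \<Rightarrow> ((nat \<Rightarrow> real) \<Rightarrow> real) \<Rightarrow> bool" where
  "has_density N X n f \<longleftrightarrow>
     f \<in> borel_measurable (Rn n) \<and> (\<forall>x\<in>space (Rn n). 0 \<le> f x) \<and>
     distributed N (Rn n) (noise_vec X n) (\<lambda>x. ennreal (f x))"

text \<open>Differential entropy \<open>-\<integral> f ln f\<close>, with values in the extended reals. (The library's
  \<open>entropy\<close> is a Bochner integral, equal to 0 whenever \<open>f ln f\<close> is not integrable.) Since
  \<open>ennreal\<close> truncates at 0, the two integrals are those of the positive and the negative part
  of \<open>-f ln f\<close>.\<close>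

definition entropy_pos :: "nat \<Rightarrow> ((nat \<Rightarrow> real) \<Rightarrow> real) \<Rightarrow> ennreal" where
  "entropy_pos n f = (\<integral>\<^sup>+ x. ennreal (- (f x * ln (f x))) \<partial>Rn n)"

definition entropy_neg :: "nat \<Rightarrow> ((nat \<Rightarrow> real) \<Rightarrow> real) \<Rightarrow> ennreal" where
  "entropy_neg n f = (\<integral>\<^sup>+ x. ennreal (f x * ln (f x)) \<partial>Rn n)"

definition diff_entropy_well_defined :: "nat \<Rightarrow> ((nat \<Rightarrow> real) \<Rightarrow> real) \<Rightarrow> bool" where
  "diff_entropy_well_defined n f \<longleftrightarrow> entropy_pos n f < \<infinity> \<or> entropy_neg n f < \<infinity>"

definition diff_entropy :: "nat \<Rightarrow> ((nat \<Rightarrow> real) \<Rightarrow> real) \<Rightarrow> ereal" where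
  "diff_entropy n f = enn2ereal (entropy_pos n f) - enn2ereal (entropy_neg n f)"

text \<open>The junk value \<open>ln 0 = 0\<close> is harmless in the next definition, since the density is almost
  surely positive at \<open>D\<^sup>n\<close>.\<close>

definition info_law ::
  "'v measure \<Rightarrow> (nat \<Rightarrow> 'v \<Rightarrow> real) \<Rightarrow> (nat \<Rightarrow> (nat \<Rightarrow> real) \<Rightarrow> real) \<Rightarrow> nat \<Rightarrow> real measure" where
  "info_law N X f n = distr N borel (\<lambda>\<omega>. - ln (f n (noise_vec X n \<omega>)) / real n)"

section \<open>Marked point processes\<close>

text \<open>A point process on \<open>\<real>\<^sup>n\<close> with infinitely many points is given by an enumeration \<open>T k\<close> of its
  points by random vectors; the mark of \<open>T k\<close> is \<open>D k\<close>.\<close>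

definition point_count :: "(nat \<Rightarrow> 'w \<Rightarrow> (nat \<Rightarrow> real)) \<Rightarrow> (nat \<Rightarrow> real) set \<Rightarrow> 'w \<Rightarrow> nat" where
  "point_count T B \<omega> = card {k. T k \<omega> \<in> B}"

text \<open>The Poisson weights are written out in order to include sets \<open>B\<close> of volume 0, which the
  library's \<open>poisson_pmf\<close>, restricted to positive rates, does not cover.\<close>

definition homogeneous_Poisson ::
  "'w measure \<Rightarrow> nat \<Rightarrow> real \<Rightarrow> (nat \<Rightarrow> 'w \<Rightarrow> (nat \<Rightarrow> real)) \<Rightarrow> bool" where
  "homogeneous_Poisson P n lam T \<longleftrightarrow>
     (\<forall>k. T k \<in> P \<rightarrow>\<^sub>M Rn n) \<and>
     (\<forall>B\<in>sets (Rn n). emeasure (Rn n) B < \<infinity> \<longrightarrow>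
        (AE \<omega> in P. finite {k. T k \<omega> \<in> B}) \<and>
        (\<forall>m. measure P {\<omega>\<in>space P. point_count T B \<omega> = m} =
             (lam * measure (Rn n) B) ^ m / fact m * exp (- (lam * measure (Rn n) B)))) \<and>
     (\<forall>m (B :: nat \<Rightarrow> (nat \<Rightarrow> real) set).
        (\<forall>i<m. B i \<in> sets (Rn n) \<and> emeasure (Rn n) (B i) < \<infinity>) \<and> disjoint_family_on B {..<m} \<longrightarrow>
        prob_space.indep_vars P (\<lambda>_. count_space UNIV) (\<lambda>i. point_count T (B i)) {..<m})"

text \<open>The marks are independent of the whole sequence of points, hence also of the way in which
  the points are enumerated.\<close>

definition iid_marks ::
  "'w measure \<Rightarrow> nat \<Rightarrow> (nat \<Rightarrow> real) measure \<Rightarrow> (nat \<Rightarrow> 'w \<Rightarrow> (nat \<Rightarrow> real)) \<Rightarrow>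
   (nat \<Rightarrow> 'w \<Rightarrow> (nat \<Rightarrow> real)) \<Rightarrow> bool" where
  "iid_marks P n Q T D \<longleftrightarrow>
     prob_space.indep_vars P (\<lambda>_. Rn n) D UNIV \<and>
     (\<forall>k. distr P (Rn n) (D k) = Q) \<and>
     prob_space.indep_var P
       (Pi\<^sub>M UNIV (\<lambda>_. Rn n)) (\<lambda>\<omega> k. T k \<omega>)
       (Pi\<^sub>M UNIV (\<lambda>_. Rn n)) (\<lambda>\<omega> k. D k \<omega>)"

definition intensity :: "'w measure \<Rightarrow> nat \<Rightarrow> (nat \<Rightarrow> 'w \<Rightarrow> (nat \<Rightarrow> real)) \<Rightarrow> ennreal" where
  "intensity P n T = (\<integral>\<^sup>+ \<omega>. (\<Sum>k. indicator (unit_cube n) (T k \<omega>)) \<partial>P)"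

text \<open>The marked point configuration, as a set of pairs (point, mark), translated so that its
  \<open>k\<close>-th point becomes the origin.\<close>

definition seen_from ::
  "nat \<Rightarrow> (nat \<Rightarrow> 'w \<Rightarrow> (nat \<Rightarrow> real)) \<Rightarrow> (nat \<Rightarrow> 'w \<Rightarrow> (nat \<Rightarrow> real)) \<Rightarrow> nat \<Rightarrow> 'w \<Rightarrow>
   ((nat \<Rightarrow> real) \<times> (nat \<Rightarrow> real)) set" where
  "seen_from n T D k \<omega> = range (\<lambda>j. (vdiff n (T j \<omega>) (T k \<omega>), D j \<omega>))"

text \<open>Palm probability of an event \<open>E\<close> about marked configurations with a point at the origin,
  by the Matthes definition (for a stationary process, with the unit cube as reference set).\<close>

definition palm_prob ::
  "'w measure \<Rightarrow> nat \<Rightarrow> (nat \<Rightarrow> 'w \<Rightarrow> (nat \<Rightarrow> real)) \<Rightarrow> (nat \<Rightarrow> 'w \<Rightarrow> (nat \<Rightarrow> real)) \<Rightarrow>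
   ((nat \<Rightarrow> real) \<times> (nat \<Rightarrow> real)) set set \<Rightarrow> ennreal" where
  "palm_prob P n T D E =
     (\<integral>\<^sup>+ \<omega>. (\<Sum>k. indicator (unit_cube n) (T k \<omega>) * indicator E (seen_from n T D k \<omega>)) \<partial>P)
       / intensity P n T"

section \<open>Maximum likelihood decoding\<close>

text \<open>\<open>f\<close> is a density on \<open>\<real>\<^sup>n\<close>, and \<open>\<Phi>\<close> is the set of points of the configuration.\<close>

definition ml_dist :: "nat \<Rightarrow> ((nat \<Rightarrow> real) \<Rightarrow> real) \<Rightarrow> (nat \<Rightarrow> real) \<Rightarrow> (nat \<Rightarrow> real) \<Rightarrow> ereal" where
  "ml_dist n f s t = - eln (ennreal (f (vdiff n s t))) / ereal (real n)"

definition strict_minimizer ::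
  "nat \<Rightarrow> ((nat \<Rightarrow> real) \<Rightarrow> real) \<Rightarrow> (nat \<Rightarrow> real) set \<Rightarrow> (nat \<Rightarrow> real) \<Rightarrow> (nat \<Rightarrow> real) \<Rightarrow> bool" where
  "strict_minimizer n f \<Phi> x t \<longleftrightarrow> ml_dist n f x t < (INF s\<in>\<Phi> - {t}. ml_dist n f x s)"

definition voronoi_cell :: "nat \<Rightarrow> (nat \<Rightarrow> real) set \<Rightarrow> (nat \<Rightarrow> real) \<Rightarrow> (nat \<Rightarrow> real) set" where
  "voronoi_cell n \<Phi> t = {x\<in>space (Rn n). \<forall>s\<in>\<Phi>. edist n x t \<le> edist n x s}"

definition decoding_region ::
  "nat \<Rightarrow> ((nat \<Rightarrow> real) \<Rightarrow> real) \<Rightarrow> (nat \<Rightarrow> real) set \<Rightarrow> (nat \<Rightarrow> real) \<Rightarrow> (nat \<Rightarrow> real) set" where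
  "decoding_region n f \<Phi> t =
     {x\<in>space (Rn n). strict_minimizer n f \<Phi> x t} \<union>
     {x\<in>space (Rn n). \<not> (\<exists>s\<in>\<Phi>. strict_minimizer n f \<Phi> x s) \<and> x \<in> voronoi_cell n \<Phi> t}"

definition error_event ::
  "nat \<Rightarrow> ((nat \<Rightarrow> real) \<Rightarrow> real) \<Rightarrow> ((nat \<Rightarrow> real) \<times> (nat \<Rightarrow> real)) set set" where
  "error_event n f =
     {\<psi>. \<exists>d. (vorigin n, d) \<in> \<psi> \<and> d \<notin> decoding_region n f (fst ` \<psi>) (vorigin n)}"

definition error_prob ::
  "'w measure \<Rightarrow> nat \<Rightarrow> ((nat \<Rightarrow> real) \<Rightarrow> real) \<Rightarrow> (nat \<Rightarrow> 'w \<Rightarrow> (nat \<Rightarrow> real)) \<Rightarrow>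
   (nat \<Rightarrow> 'w \<Rightarrow> (nat \<Rightarrow> real)) \<Rightarrow> ennreal" where
  "error_prob P n f T D = palm_prob P n T D (error_event n f)"

definition error_exponent :: "(nat \<Rightarrow> ennreal) \<Rightarrow> ereal" where
  "error_exponent p = liminf (\<lambda>n. - eln (p n) / ereal (real n))"

section \<open>The bound\<close>

definition J_fun :: "(real \<Rightarrow> ereal) \<Rightarrow> real \<Rightarrow> ereal" where
  "J_fun I u = (SUP s\<in>{..u}. ereal s - I s)"

definition F_fun :: "real \<Rightarrow> real \<Rightarrow> (real \<Rightarrow> ereal) \<Rightarrow> real \<Rightarrow> ereal" where
  "F_fun \<alpha> h I u = max (ereal (ln \<alpha> + h) - J_fun I u) 0"

end

theory Submission
  imports Defs "HOL-Real_Asymp.Real_Asymp"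
begin

text \<open>Write \<open>\<lambda>\<close> for the intensity, \<open>f\<close> for the noise density and \<open>\<rho>\<close> for the law of
  \<open>- ln (f D) / n\<close>. A point with noise \<open>d\<close> is decoded wrongly only if another point falls into a
  translate of \<open>d - {z. f z \<ge> exp (- 1) * f d}\<close>; the factor \<open>exp (- 1)\<close> covers the possibility that the
  infimum over the other points is not attained, and costs only \<open>1 / n\<close> on the exponential scale. Since
  the second factorial moment measure of a Poisson process is \<open>\<lambda>\<^sup>2\<close> times Lebesgue measure, the error
  probability is at most \<open>E (min 1 (\<lambda> * vol {z. f z \<ge> exp (- 1) * f D}))\<close>. The volume of
  \<open>{f \<ge> exp (- n w)}\<close> is at most \<open>\<integral>\<^bsub>s \<le> w\<^esub> exp (n s) \<rho>(ds)\<close>, because \<open>f\<close> is the density of the noise, and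
  by the large deviation upper bound it grows at rate at most \<open>J(w)\<close>; a second Laplace estimate
  for the outer expectation gives \<open>inf (F + I)\<close>. Both estimates work by covering a compact
  interval with finitely many small ones, using that \<open>I\<close> is lower semicontinuous and \<open>J\<close> is
  upper semicontinuous from the right.\<close>

section \<open>Exponential estimates from the large deviation principle\<close>

lemma eln_div_lessD:
  assumes "eln p / ereal (real n) < ereal (- r)" "n \<ge> 1"
  shows "p \<le> ennreal (exp (- (real n * r)))"
proof -
  consider "p = 0" | "p = \<infinity>" | x where "p = ennreal x" "x > 0"
    by (cases p) (auto simp: less_le)
  then show ?thesis
  proof cases
    case 2
    then show ?thesis using assms by (simp add: eln_def)
  next
    case (3 x)
    then have "ln x / real n < - r" using assms by (simp add: eln_def)
    then have "ln x < - (real n * r)" using assms(2) by (simp add: field_simps)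
    then have "x < exp (- (real n * r))" using 3
      by (metis exp_less_cancel_iff exp_ln)
    then show ?thesis using 3 by (simp add: ennreal_leI)
  qed simp
qed

lemma le_neg_eln_div:
  assumes "p \<le> ennreal (exp (- (real n * c)))" "n \<ge> 1"
  shows "ereal c \<le> - eln p / ereal (real n)"
proof -
  consider "p = 0" | "p = \<infinity>" | x where "p = ennreal x" "x > 0"
    by (cases p) (auto simp: less_le)
  then show ?thesis
  proof cases
    case 2
    then show ?thesis using assms by (simp add: top_unique)
  next
    case (3 x)
    then have "x \<le> exp (- (real n * c))" using assms by (simp add: ennreal_le_iff)
    then have "ln x \<le> - (real n * c)" using 3 by (metis ln_exp ln_mono)
    then have "c \<le> - ln x / real n" using assms(2) by (simp add: field_simps)
    then show ?thesis using 3 assms(2) by (simp add: eln_def)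
  qed (use assms in \<open>simp add: eln_def\<close>)
qed

text \<open>The large deviation principle controls only a limsup; giving up part of the exponent
  (\<open>r' < r\<close>) turns it into an inequality for all large \<open>n\<close>. Since
  \<open>r\<close> is real, sets on which \<open>I\<close> is infinite are covered as well.\<close>

lemma LDP_closed_upper:
  assumes "LDP \<rho> I" "closed C" and r: "\<And>s. s \<in> C \<Longrightarrow> ereal r \<le> I s" "r' < r"
  shows "\<forall>\<^sub>F n in sequentially. emeasure (\<rho> n) C \<le> ennreal (exp (- (real n * r')))"
proof -
  have "limsup (\<lambda>n. eln (emeasure (\<rho> n) C) / ereal (real n)) \<le> - (INF s\<in>C. I s)"
    using assms(1,2) by (auto simp: LDP_def)
  also have "\<dots> \<le> - ereal r"
    using r(1) by (simp only: ereal_minus_le_minus) (rule INF_greatest)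
  also have "\<dots> < ereal (- r')" using r(2) by simp
  finally have "\<forall>\<^sub>F n in sequentially. eln (emeasure (\<rho> n) C) / ereal (real n) < ereal (- r')"
    by (rule Limsup_lessD)
  then show ?thesis
    using eventually_ge_at_top[of 1] by eventually_elim (rule eln_div_lessD)
qed

text \<open>A fixed number of terms costs only the constant factor \<open>card S\<close>, which
  \<open>exp (n * (c - c'))\<close> eventually exceeds.\<close>

lemma eventually_sum_le_exp:
  fixes a :: "'i \<Rightarrow> nat \<Rightarrow> ennreal"
  assumes "finite S" "\<And>i. i \<in> S \<Longrightarrow> \<forall>\<^sub>F n in sequentially. a i n \<le> ennreal (exp (- (real n * c)))"
    and "c' < c"
  shows "\<forall>\<^sub>F n in sequentially. (\<Sum>i\<in>S. a i n) \<le> ennreal (exp (- (real n * c')))"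
proof -
  have "filterlim (\<lambda>n. exp (real n * (c - c'))) at_top sequentially"
    using assms(3) by real_asymp
  then have "\<forall>\<^sub>F n in sequentially. real (card S) \<le> exp (real n * (c - c'))"
    by (simp add: filterlim_at_top)
  moreover have "\<forall>\<^sub>F n in sequentially. \<forall>i\<in>S. a i n \<le> ennreal (exp (- (real n * c)))"
    using assms(1,2) by (simp add: eventually_ball_finite)
  ultimately show ?thesis
  proof eventually_elim
    case (elim n)
    have "(\<Sum>i\<in>S. a i n) \<le> (\<Sum>i\<in>S. ennreal (exp (- (real n * c))))"
      using elim by (intro sum_mono) auto
    also have "\<dots> = ennreal (real (card S) * exp (- (real n * c)))"
      by (simp add: ennreal_mult ennreal_of_nat_eq_real_of_nat)
    also have "\<dots> \<le> ennreal (exp (real n * (c - c')) * exp (- (real n * c)))"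
      using elim by (intro ennreal_leI mult_right_mono) auto
    also have "\<dots> = ennreal (exp (- (real n * c')))"
      by (simp add: exp_add[symmetric] algebra_simps)
    finally show ?case .
  qed
qed

lemma eventually_add_le_exp:
  fixes a b :: "nat \<Rightarrow> ennreal"
  assumes "\<forall>\<^sub>F n in sequentially. a n \<le> ennreal (exp (- (real n * c)))"
    and "\<forall>\<^sub>F n in sequentially. b n \<le> ennreal (exp (- (real n * c)))" and "c' < c"
  shows "\<forall>\<^sub>F n in sequentially. a n + b n \<le> ennreal (exp (- (real n * c')))"
  using eventually_sum_le_exp[of "UNIV :: bool set" "\<lambda>i. if i then a else b" c c'] assms
  by (simp add: UNIV_bool add.commute)

text \<open>Finitely many of the local intervals cover \<open>K\<close>, and the integral is at most
  the sum of the local ones. The intervals are closed so that the large deviation upper bound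
  applies to them; their interiors form the open cover.\<close>

lemma compact_integral_le_exp:
  fixes g :: "nat \<Rightarrow> real \<Rightarrow> ennreal"
  assumes "compact K" and g: "\<And>n. g n \<in> borel_measurable borel"
    and \<rho>: "\<And>n. sets (\<rho> n) = sets borel"
    and loc: "\<And>u. u \<in> K \<Longrightarrow> \<exists>\<delta>>0. \<forall>\<^sub>F n in sequentially.
       (\<integral>\<^sup>+ s\<in>{u - \<delta>..u + \<delta>}. g n s \<partial>\<rho> n) \<le> ennreal (exp (- (real n * c)))"
    and "c' < c"
  shows "\<forall>\<^sub>F n in sequentially. (\<integral>\<^sup>+ s\<in>K. g n s \<partial>\<rho> n) \<le> ennreal (exp (- (real n * c')))"
proof -
  have "\<exists>\<delta>. \<forall>u\<in>K. \<delta> u > 0 \<and> (\<forall>\<^sub>F n in sequentially.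
       (\<integral>\<^sup>+ s\<in>{u - \<delta> u..u + \<delta> u}. g n s \<partial>\<rho> n) \<le> ennreal (exp (- (real n * c))))"
    by (intro bchoice ballI loc)
  then obtain \<delta> where \<delta>: "\<And>u. u \<in> K \<Longrightarrow> \<delta> u > 0"
    "\<And>u. u \<in> K \<Longrightarrow> \<forall>\<^sub>F n in sequentially.
       (\<integral>\<^sup>+ s\<in>{u - \<delta> u..u + \<delta> u}. g n s \<partial>\<rho> n) \<le> ennreal (exp (- (real n * c)))"
    by blast
  obtain S where S: "S \<subseteq> K" "finite S" "K \<subseteq> (\<Union>u\<in>S. {u - \<delta> u <..< u + \<delta> u})"
  proof (rule compactE_image[OF \<open>compact K\<close>])
    show "open {u - \<delta> u <..< u + \<delta> u}" for u by simp
    show "K \<subseteq> (\<Union>u\<in>K. {u - \<delta> u <..< u + \<delta> u})" using \<delta>(1) by force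
  qed (rule that)
  have "\<forall>\<^sub>F n in sequentially. (\<Sum>u\<in>S. \<integral>\<^sup>+ s\<in>{u - \<delta> u..u + \<delta> u}. g n s \<partial>\<rho> n)
      \<le> ennreal (exp (- (real n * c')))"
    using S \<delta>(2) \<open>c' < c\<close> by (intro eventually_sum_le_exp[where c = c]) auto
  then show ?thesis
  proof eventually_elim
    case (elim n)
    have [measurable_cong]: "sets (\<rho> n) = sets borel" by (rule \<rho>)
    note [measurable] = g[of n]
    have "(\<integral>\<^sup>+ s\<in>K. g n s \<partial>\<rho> n) \<le> (\<integral>\<^sup>+ s. (\<Sum>u\<in>S. g n s * indicator {u - \<delta> u..u + \<delta> u} s) \<partial>\<rho> n)"
    proof (rule nn_integral_mono)
      fix s
      show "g n s * indicator K s \<le> (\<Sum>u\<in>S. g n s * indicator {u - \<delta> u..u + \<delta> u} s)"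
      proof (cases "s \<in> K")
        case True
        then obtain u where u: "u \<in> S" "s \<in> {u - \<delta> u..u + \<delta> u}" using S(3) by fastforce
        then have "g n s * indicator K s \<le> g n s * indicator {u - \<delta> u..u + \<delta> u} s"
          using True by simp
        also have "\<dots> \<le> (\<Sum>u\<in>S. g n s * indicator {u - \<delta> u..u + \<delta> u} s)"
          by (rule member_le_sum[OF u(1)]) (use S in auto)
        finally show ?thesis .
      qed simp
    qed
    also have "\<dots> = (\<Sum>u\<in>S. \<integral>\<^sup>+ s\<in>{u - \<delta> u..u + \<delta> u}. g n s \<partial>\<rho> n)"
      by (rule nn_integral_sum) simp
    finally show ?case using elim by order
  qed
qed

section \<open>Semicontinuity of the rate function and of \<open>J_fun\<close>\<close>

lemma good_rate_nbhd:
  assumes "good_rate_function I" "ereal r < I u"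
  shows "\<exists>\<delta>>0. \<forall>s\<in>{u - \<delta>..u + \<delta>}. ereal r < I s"
proof -
  have "ereal r < Liminf (at u) I" using assms by (auto simp: good_rate_function_def intro: less_le_trans)
  then have "\<forall>\<^sub>F s in at u. ereal r < I s" by (rule less_LiminfD)
  then obtain d where d: "d > 0" "\<And>s. s \<noteq> u \<Longrightarrow> dist s u < d \<Longrightarrow> ereal r < I s"
    by (auto simp: eventually_at)
  \<comment> \<open>Halving \<open>d\<close> puts the closed interval inside the open ball. The
    filter \<open>at u\<close> omits \<open>u\<close> itself, where the hypothesis on
    \<open>I u\<close> takes over.\<close>
  show ?thesis
  proof (intro exI[of _ "d/2"] conjI ballI)
    fix s assume "s \<in> {u - d/2..u + d/2}"
    then have "dist s u < d" using d(1) by (auto simp: dist_real_def)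
    then show "ereal r < I s" using d(2) assms(2) by (cases "s = u") auto
  qed (use d in simp)
qed

lemma ereal_diff_less_iff: "ereal u - x < ereal b \<longleftrightarrow> ereal (u - b) < x"
  by (cases x) auto

lemma J_fun_lessD: "J_fun I w < ereal b \<Longrightarrow> u \<le> w \<Longrightarrow> ereal (u - b) < I u"
  unfolding J_fun_def ereal_diff_less_iff[symmetric]
  by (rule le_less_trans[OF SUP_upper]) auto

text \<open>Moving \<open>u\<close> to the right adds only values \<open>s - I s\<close> with
  \<open>s\<close> just above \<open>u\<close>. Lower semicontinuity of \<open>I\<close> carries the
  bound \<open>u - b0 < I u\<close> over to such \<open>s\<close>, and the growth of the linear term
  is absorbed by the gap between \<open>b0\<close> and \<open>b1\<close>.\<close>

lemma J_fun_right_usc: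
  assumes "good_rate_function I" "J_fun I u < ereal b"
  shows "\<exists>\<delta>>0. J_fun I (u + \<delta>) < ereal b"
proof -
  obtain b0 where b0: "J_fun I u < ereal b0" "b0 < b"
    using ereal_dense2[OF assms(2)] by auto
  \<comment> \<open>The supremum of values at most \<open>b1\<close> may equal \<open>b1\<close>, so
    strictness in the end comes from \<open>b1 < b\<close>.\<close>
  obtain b1 where b1: "b0 < b1" "b1 < b" using b0(2) dense by blast
  obtain \<delta> where \<delta>: "\<delta> > 0" "\<And>s. s \<in> {u - \<delta>..u + \<delta>} \<Longrightarrow> ereal (u - b0) < I s"
    using good_rate_nbhd[OF assms(1) J_fun_lessD[OF b0(1) order_refl]] by auto
  define d where "d = min \<delta> (b1 - b0)"
  have "J_fun I (u + d) \<le> ereal b1"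
    unfolding J_fun_def
  proof (rule SUP_least)
    fix s assume s: "s \<in> {..u + d}"
    show "ereal s - I s \<le> ereal b1"
    proof (cases "s \<le> u")
      case True
      then have "ereal s - I s \<le> J_fun I u" unfolding J_fun_def by (intro SUP_upper) auto
      also have "\<dots> \<le> ereal b1" using b0 b1 by (meson ereal_less_eq(3) less_le_trans less_imp_le)
      finally show ?thesis .
    next
      case False
      then have "s \<in> {u - \<delta>..u + \<delta>}" using s \<delta>(1) by (auto simp: d_def)
      then have "ereal (u - b0) < I s" by (rule \<delta>(2))
      moreover have "s - b1 \<le> u - b0" using s by (auto simp: d_def)
      ultimately have "ereal (s - b1) < I s" by (meson ereal_less_eq(3) le_less_trans)
      then show ?thesis unfolding ereal_diff_less_iff[symmetric] by simp
    qed
  qed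
  also have "\<dots> < ereal b" using b1 by simp
  finally show ?thesis using \<delta> b1 by (intro exI[of _ d]) (auto simp: d_def)
qed

text \<open>The upper half of Varadhan's lemma for \<open>exp (n * s)\<close> on
  \<open>s \<le> w\<close>: on a short interval around \<open>u\<close>, integrand times mass has
  exponent about \<open>u - I u\<close>, which is at most \<open>J_fun I w\<close>. Below
  \<open>b0\<close>, total mass at most 1 suffices, which leaves the compact interval from
  \<open>b0\<close> to \<open>w\<close>.\<close>

lemma Laplace_upper:
  assumes "LDP \<rho> I" "good_rate_function I"
    and \<rho>: "\<And>n. sets (\<rho> n) = sets borel" "\<And>n. emeasure (\<rho> n) (space (\<rho> n)) \<le> 1"
    and b: "J_fun I w < ereal b"
  shows "\<forall>\<^sub>F n in sequentially.
    (\<integral>\<^sup>+ s\<in>{..w}. ennreal (exp (real n * s)) \<partial>\<rho> n) \<le> ennreal (exp (real n * b))"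
proof -
  obtain b0 where b0: "J_fun I w < ereal b0" "b0 < b"
    using ereal_dense2[OF b] by auto
  \<comment> \<open>Exponent is spent twice: from \<open>b0\<close> to \<open>b1\<close> for the
    finite cover, from \<open>b1\<close> to \<open>b\<close> for adding the part below
    \<open>b0\<close>.\<close>
  obtain b1 where b1: "b0 < b1" "b1 < b" using b0(2) dense by blast
  have "\<exists>\<delta>>0. \<forall>\<^sub>F n in sequentially. (\<integral>\<^sup>+ s\<in>{u - \<delta>..u + \<delta>}. ennreal (exp (real n * s)) \<partial>\<rho> n)
      \<le> ennreal (exp (- (real n * - b0)))" if u: "u \<in> {b0..w}" for u
  proof -
    obtain r where r: "u - b0 < r" "ereal r < I u"
      using ereal_dense2[OF J_fun_lessD[OF b0(1), of u]] u by auto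
    obtain \<delta>0 where \<delta>0: "\<delta>0 > 0" "\<And>s. s \<in> {u - \<delta>0..u + \<delta>0} \<Longrightarrow> ereal r < I s"
      using good_rate_nbhd[OF assms(2) r(2)] by auto
    \<comment> \<open>Half the slack keeps \<open>u + \<delta> - b0\<close> below \<open>r\<close>;
      this is the decay of mass that offsets the largest value
      \<open>exp (n * (u + \<delta>))\<close> of the integrand.\<close>
    define \<delta> where "\<delta> = min \<delta>0 ((r - (u - b0)) / 2)"
    have \<delta>: "\<delta> > 0" "u + \<delta> - b0 < r" using \<delta>0 r by (auto simp: \<delta>_def min_def field_simps)
    have "\<forall>\<^sub>F n in sequentially. emeasure (\<rho> n) {u - \<delta>..u + \<delta>} \<le> ennreal (exp (- (real n * (u + \<delta> - b0))))"
    proof (rule LDP_closed_upper[OF assms(1) _ _ \<delta>(2)])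
      fix s assume "s \<in> {u - \<delta>..u + \<delta>}"
      then have "s \<in> {u - \<delta>0..u + \<delta>0}" by (auto simp: \<delta>_def)
      then show "ereal r \<le> I s" using \<delta>0 less_imp_le by blast
    qed simp
    then have "\<forall>\<^sub>F n in sequentially. (\<integral>\<^sup>+ s\<in>{u - \<delta>..u + \<delta>}. ennreal (exp (real n * s)) \<partial>\<rho> n)
      \<le> ennreal (exp (- (real n * - b0)))"
    proof eventually_elim
      case (elim n)
      have "(\<integral>\<^sup>+ s\<in>{u - \<delta>..u + \<delta>}. ennreal (exp (real n * s)) \<partial>\<rho> n)
          \<le> (\<integral>\<^sup>+ s. ennreal (exp (real n * (u + \<delta>))) * indicator {u - \<delta>..u + \<delta>} s \<partial>\<rho> n)"
        by (intro nn_integral_mono) (auto split: split_indicator intro!: ennreal_leI mult_left_mono)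
      also have "\<dots> = ennreal (exp (real n * (u + \<delta>))) * emeasure (\<rho> n) {u - \<delta>..u + \<delta>}"
        by (rule nn_integral_cmult_indicator) (simp add: \<rho>)
      also have "\<dots> \<le> ennreal (exp (real n * (u + \<delta>))) * ennreal (exp (- (real n * (u + \<delta> - b0))))"
        using elim by (rule mult_left_mono) simp
      also have "\<dots> = ennreal (exp (- (real n * - b0)))"
        by (simp add: ennreal_mult[symmetric] exp_add[symmetric] algebra_simps)
      finally show ?case .
    qed
    then show ?thesis using \<delta>(1) by blast
  qed
  then have "\<forall>\<^sub>F n in sequentially. (\<integral>\<^sup>+ s\<in>{b0..w}. ennreal (exp (real n * s)) \<partial>\<rho> n)
      \<le> ennreal (exp (- (real n * - b1)))"
    using b1 by (intro compact_integral_le_exp[where c = "- b0"]) (auto simp: \<rho>)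
  moreover have "\<forall>\<^sub>F n in sequentially. (\<integral>\<^sup>+ s\<in>{..b0}. ennreal (exp (real n * s)) \<partial>\<rho> n)
      \<le> ennreal (exp (- (real n * - b1)))"
  proof (rule always_eventually, rule allI)
    fix n
    have "(\<integral>\<^sup>+ s\<in>{..b0}. ennreal (exp (real n * s)) \<partial>\<rho> n) \<le> (\<integral>\<^sup>+ s. ennreal (exp (real n * b1)) \<partial>\<rho> n)"
      using b1 by (intro nn_integral_mono) (auto split: split_indicator intro!: ennreal_leI mult_left_mono)
    also have "\<dots> = ennreal (exp (real n * b1)) * emeasure (\<rho> n) (space (\<rho> n))"
      by simp
    also have "\<dots> \<le> ennreal (exp (real n * b1)) * 1"
      using \<rho>(2) by (rule mult_left_mono) simp
    finally show "(\<integral>\<^sup>+ s\<in>{..b0}. ennreal (exp (real n * s)) \<partial>\<rho> n) \<le> ennreal (exp (- (real n * - b1)))"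
      by simp
  qed
  ultimately have "\<forall>\<^sub>F n in sequentially. (\<integral>\<^sup>+ s\<in>{b0..w}. ennreal (exp (real n * s)) \<partial>\<rho> n)
      + (\<integral>\<^sup>+ s\<in>{..b0}. ennreal (exp (real n * s)) \<partial>\<rho> n) \<le> ennreal (exp (- (real n * - b)))"
    using b1 by (intro eventually_add_le_exp[where c = "- b1"]) auto
  then show ?thesis
  proof eventually_elim
    case (elim n)
    have [measurable_cong]: "sets (\<rho> n) = sets borel" by (rule \<rho>)
    have "(\<integral>\<^sup>+ s\<in>{..w}. ennreal (exp (real n * s)) \<partial>\<rho> n)
      \<le> (\<integral>\<^sup>+ s. ennreal (exp (real n * s)) * indicator {b0..w} s
            + ennreal (exp (real n * s)) * indicator {..b0} s \<partial>\<rho> n)"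
      by (intro nn_integral_mono) (auto split: split_indicator)
    also have "\<dots> = (\<integral>\<^sup>+ s\<in>{b0..w}. ennreal (exp (real n * s)) \<partial>\<rho> n)
      + (\<integral>\<^sup>+ s\<in>{..b0}. ennreal (exp (real n * s)) \<partial>\<rho> n)"
      by (rule nn_integral_add) measurable
    finally show ?case using elim by simp
  qed
qed

section \<open>The exponential rate of a truncated nested integral\<close>

lemma ereal_less_add_split:
  assumes "0 \<le> x" "0 \<le> y" "ereal c < x + y"
  obtains p q where "ereal p < x" "ereal q < y" "c < p + q"
proof -
  consider "x = \<infinity>" | "y = \<infinity>" | a b where "x = ereal a" "y = ereal b"
    using assms by (cases x; cases y) auto
  then show ?thesis
  proof cases
    case 1
    then show ?thesis using assms that[of "c + 2" "-1"] by (cases y) auto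
  next
    case 2
    \<comment> \<open>The other summand may be 0, so its strict lower threshold is taken negative;
      \<open>c + 2\<close> makes up for it.\<close>
    then show ?thesis using assms that[of "-1" "c + 2"] by (cases x) auto
  next
    case (3 a b)
    then have "c < a + b" using assms by simp
    then show ?thesis using 3 that[of "a - (a + b - c) / 3" "b - (a + b - c) / 3"]
      by (auto simp: field_simps)
  qed
qed

text \<open>Writing the range of integration as a jointly measurable factor of \<open>w\<close> and
  \<open>t\<close> reduces this to measurability of a parametrised integral, for which finiteness
  supplies sigma-finiteness.\<close>

lemma measurable_nn_integral_atMost:
  fixes M :: "real measure"
  assumes "finite_measure M" and [measurable_cong]: "sets M = sets borel"
    and [measurable]: "g \<in> borel_measurable borel"
  shows "(\<lambda>w. \<integral>\<^sup>+ t\<in>{..w}. g t \<partial>M) \<in> borel_measurable borel"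
proof -
  interpret finite_measure M by fact
  have "(\<lambda>w. \<integral>\<^sup>+ t. g t * (if t \<le> w then 1 else 0) \<partial>M) \<in> borel_measurable borel"
    by measurable
  then show ?thesis by (simp add: indicator_def of_bool_def)
qed

text \<open>The large deviation part, free of point processes: \<open>exp (- (n * L))\<close> stands
  for the intensity and the inner integral for a volume bound. Near \<open>u\<close> the truncated
  product decays at rate \<open>max (L - J_fun I u) 0\<close> and the outer mass at rate
  \<open>I u\<close>, up to arbitrarily small losses.\<close>

lemma error_exponent_bound:
  fixes L :: real
  assumes "LDP \<rho> I" "good_rate_function I"
    and \<rho>: "\<And>n. sets (\<rho> n) = sets borel" "\<And>n. emeasure (\<rho> n) (space (\<rho> n)) \<le> 1"
    and p: "\<And>n. n \<ge> 1 \<Longrightarrow> p n \<le> (\<integral>\<^sup>+ s. min 1 (ennreal (exp (- (real n * L)))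
        * (\<integral>\<^sup>+ t\<in>{..s + 1 / real n}. ennreal (exp (real n * t)) \<partial>\<rho> n)) \<partial>\<rho> n)"
  shows "(INF u. max (ereal L - J_fun I u) 0 + I u) \<le> error_exponent p"
proof -
  define V where "V n w = (\<integral>\<^sup>+ t\<in>{..w}. ennreal (exp (real n * t)) \<partial>\<rho> n)" for n w
  define g where "g n s = min 1 (ennreal (exp (- (real n * L))) * V n (s + 1 / real n))" for n s
  have V_mono: "V n w \<le> V n w'" if "w \<le> w'" for n w w'
    unfolding V_def using that by (intro nn_integral_mono) (auto split: split_indicator)
  have g_meas: "g n \<in> borel_measurable borel" for n
  proof -
    have "finite_measure (\<rho> n)"
      using \<rho>(2)[of n] by (intro finite_measureI) (auto simp: top_unique)
    then have [measurable]: "V n \<in> borel_measurable borel"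
      unfolding V_def by (intro measurable_nn_integral_atMost \<rho>) auto
    show ?thesis unfolding g_def by measurable
  qed
  define A where "A = (INF u. max (ereal L - J_fun I u) 0 + I u)"
  have I_nonneg: "0 \<le> I s" for s using assms(2) by (simp add: good_rate_function_def)
  have bound: "\<forall>\<^sub>F n in sequentially. p n \<le> ennreal (exp (- (real n * c)))" if c: "ereal c < A" for c
  proof -
    obtain c2 where c2: "c < c2" "ereal c2 < A" using ereal_dense2[OF c] by auto
    obtain c1 where c1: "c < c1" "c1 < c2" using c2(1) dense by blast
    have "\<exists>\<delta>>0. \<forall>\<^sub>F n in sequentially. (\<integral>\<^sup>+ s\<in>{u - \<delta>..u + \<delta>}. g n s \<partial>\<rho> n)
        \<le> ennreal (exp (- (real n * c2)))" for u
    proof -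
      have "ereal c2 < I u + max (ereal L - J_fun I u) 0"
        using c2(2) INF_lower[of u UNIV "\<lambda>u. max (ereal L - J_fun I u) 0 + I u"]
        by (auto simp: A_def add.commute)
      \<comment> \<open>\<open>a\<close> is a rate for the outer mass near \<open>u\<close> and
        \<open>q\<close> one for the truncated product; the excess of \<open>a + q\<close> over
        \<open>c2\<close> is what \<open>LDP_closed_upper\<close> gives up.\<close>
      then obtain a q where aq: "ereal a < I u" "ereal q < max (ereal L - J_fun I u) 0" "c2 < a + q"
        using ereal_less_add_split[of "I u"] I_nonneg by (metis max.cobounded2)
      obtain \<delta>1 where \<delta>1: "\<delta>1 > 0" "\<And>s. s \<in> {u - \<delta>1..u + \<delta>1} \<Longrightarrow> ereal a < I s"
        using good_rate_nbhd[OF assms(2) aq(1)] by auto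
      have "\<exists>\<delta>2>0. \<forall>\<^sub>F n in sequentially.
          min 1 (ennreal (exp (- (real n * L))) * V n (u + \<delta>2)) \<le> ennreal (exp (- (real n * q)))"
      \<comment> \<open>For negative \<open>q\<close> the required bound is at least 1, so
        truncation by 1 gives it. Otherwise the maximum is \<open>L - J_fun I u\<close>, and
        \<open>Laplace_upper\<close> applies slightly to the right of \<open>u\<close>.\<close>
      proof (cases "q < 0")
        case True
        then show ?thesis
          by (intro exI[of _ 1] conjI always_eventually allI min.coboundedI1)
            (auto simp: mult_nonneg_nonpos)
      next
        case False
        then have "ereal q < ereal L - J_fun I u" using aq(2) by (auto simp: max_def split: if_splits)
        then have "J_fun I u < ereal (L - q)" by (cases "J_fun I u") auto
        then obtain \<delta> where \<delta>: "\<delta> > 0" "J_fun I (u + \<delta>) < ereal (L - q)"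
          using J_fun_right_usc[OF assms(2)] by blast
        have "\<forall>\<^sub>F n in sequentially. V n (u + \<delta>) \<le> ennreal (exp (real n * (L - q)))"
          unfolding V_def by (rule Laplace_upper[OF assms(1,2) \<rho> \<delta>(2)])
        then have "\<forall>\<^sub>F n in sequentially.
          min 1 (ennreal (exp (- (real n * L))) * V n (u + \<delta>)) \<le> ennreal (exp (- (real n * q)))"
        proof eventually_elim
          case (elim n)
          have "ennreal (exp (- (real n * L))) * V n (u + \<delta>)
              \<le> ennreal (exp (- (real n * L))) * ennreal (exp (real n * (L - q)))"
            using elim by (rule mult_left_mono) simp
          also have "\<dots> = ennreal (exp (- (real n * q)))"
            by (simp add: ennreal_mult[symmetric] exp_add[symmetric] algebra_simps)
          finally show ?case by (rule min.coboundedI2)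
        qed
        then show ?thesis using \<delta>(1) by blast
      qed
      then obtain \<delta>2 where \<delta>2: "\<delta>2 > 0" "\<forall>\<^sub>F n in sequentially.
          min 1 (ennreal (exp (- (real n * L))) * V n (u + \<delta>2)) \<le> ennreal (exp (- (real n * q)))"
        by blast
      \<comment> \<open>Half of \<open>\<delta>2\<close> leaves room for the shift:
        \<open>s + 1 / n \<le> u + \<delta>2\<close> as soon as
        \<open>1 / n < \<delta>\<close>.\<close>
      define \<delta> where "\<delta> = min \<delta>1 (\<delta>2 / 2)"
      have \<delta>: "\<delta> > 0" using \<delta>1 \<delta>2 by (simp add: \<delta>_def)
      have "\<forall>\<^sub>F n in sequentially. 1 / real n < \<delta>"
        using \<delta> by real_asymp
      moreover have "\<forall>\<^sub>F n in sequentially. emeasure (\<rho> n) {u - \<delta>..u + \<delta>}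
          \<le> ennreal (exp (- (real n * (c2 - q))))"
      proof (rule LDP_closed_upper[OF assms(1)])
        fix s assume "s \<in> {u - \<delta>..u + \<delta>}"
        then have "s \<in> {u - \<delta>1..u + \<delta>1}" by (auto simp: \<delta>_def)
        then show "ereal a \<le> I s" using \<delta>1 less_imp_le by blast
      qed (use aq in auto)
      ultimately have "\<forall>\<^sub>F n in sequentially. (\<integral>\<^sup>+ s\<in>{u - \<delta>..u + \<delta>}. g n s \<partial>\<rho> n)
        \<le> ennreal (exp (- (real n * c2)))"
        using \<delta>2(2)
      proof eventually_elim
        case (elim n)
        have "g n s \<le> ennreal (exp (- (real n * q)))" if "s \<in> {u - \<delta>..u + \<delta>}" for s
        proof -
          have "s + 1 / real n \<le> u + \<delta>2" using that elim(1) by (auto simp: \<delta>_def)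
          then have "g n s \<le> min 1 (ennreal (exp (- (real n * L))) * V n (u + \<delta>2))"
            unfolding g_def by (intro min.mono mult_left_mono V_mono) auto
          then show ?thesis using elim(3) by order
        qed
        then have "(\<integral>\<^sup>+ s\<in>{u - \<delta>..u + \<delta>}. g n s \<partial>\<rho> n)
            \<le> (\<integral>\<^sup>+ s. ennreal (exp (- (real n * q))) * indicator {u - \<delta>..u + \<delta>} s \<partial>\<rho> n)"
          by (intro nn_integral_mono) (auto split: split_indicator)
        also have "\<dots> = ennreal (exp (- (real n * q))) * emeasure (\<rho> n) {u - \<delta>..u + \<delta>}"
          by (rule nn_integral_cmult_indicator) (simp add: \<rho>)
        also have "\<dots> \<le> ennreal (exp (- (real n * q))) * ennreal (exp (- (real n * (c2 - q))))"
          using elim(2) by (rule mult_left_mono) simp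
        also have "\<dots> = ennreal (exp (- (real n * c2)))"
          by (simp add: ennreal_mult[symmetric] exp_add[symmetric] algebra_simps)
        finally show ?case .
      qed
      then show ?thesis using \<delta> by blast
    qed
    note loc = this
    \<comment> \<open>Goodness of \<open>I\<close> confines the rates up to \<open>c2\<close> to a
      bounded interval; outside it \<open>g\<close> is at most 1 and the mass alone decays fast
      enough.\<close>
    have "bounded {s. I s \<le> ereal c2}"
      using assms(2) by (auto simp: good_rate_function_def intro: compact_imp_bounded)
    then obtain R where R: "\<And>s. I s \<le> ereal c2 \<Longrightarrow> \<bar>s\<bar> < R"
      by (auto simp: bounded_pos_less)
    have "closed {s::real. R \<le> \<bar>s\<bar>}" by (intro closed_Collect_le continuous_intros)
    then have "\<forall>\<^sub>F n in sequentially. emeasure (\<rho> n) {s. R \<le> \<bar>s\<bar>} \<le> ennreal (exp (- (real n * c1)))"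
    proof (rule LDP_closed_upper[OF assms(1) _ _ c1(2)])
      fix s assume "s \<in> {s. R \<le> \<bar>s\<bar>}"
      then show "ereal c2 \<le> I s" using R[of s] by (cases "I s \<le> ereal c2") auto
    qed
    moreover have "\<forall>\<^sub>F n in sequentially. (\<integral>\<^sup>+ s\<in>{-R..R}. g n s \<partial>\<rho> n) \<le> ennreal (exp (- (real n * c1)))"
      by (rule compact_integral_le_exp[OF _ g_meas \<rho>(1) loc c1(2)]) simp
    ultimately have "\<forall>\<^sub>F n in sequentially. emeasure (\<rho> n) {s. R \<le> \<bar>s\<bar>} + (\<integral>\<^sup>+ s\<in>{-R..R}. g n s \<partial>\<rho> n)
       \<le> ennreal (exp (- (real n * c)))"
      using c1(1) by (rule eventually_add_le_exp)
    then show ?thesis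
      using eventually_ge_at_top[of 1]
    proof eventually_elim
      case (elim n)
      have [measurable_cong]: "sets (\<rho> n) = sets borel" by (rule \<rho>)
      note [measurable] = g_meas[of n]
      have "p n \<le> (\<integral>\<^sup>+ s. g n s \<partial>\<rho> n)" using p[OF elim(2)] by (simp add: g_def V_def)
      also have "\<dots> \<le> (\<integral>\<^sup>+ s. indicator {s. R \<le> \<bar>s\<bar>} s + g n s * indicator {-R..R} s \<partial>\<rho> n)"
        by (intro nn_integral_mono) (auto split: split_indicator simp: g_def)
      also have "\<dots> = emeasure (\<rho> n) {s. R \<le> \<bar>s\<bar>} + (\<integral>\<^sup>+ s\<in>{-R..R}. g n s \<partial>\<rho> n)"
        by (subst nn_integral_add) (auto simp: \<rho> nn_integral_indicator)
      finally show ?case using elim(1) by order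
    qed
  qed
  \<comment> \<open>Every extended real below \<open>A\<close> lies below some real \<open>c\<close>
    that is still below \<open>A\<close>, so the bounds for real \<open>c\<close> suffice.\<close>
  have "A \<le> liminf (\<lambda>n. - eln (p n) / ereal (real n))"
    unfolding le_Liminf_iff
  proof (intro allI impI)
    fix y assume "y < A"
    then obtain c where c: "y < ereal c" "ereal c < A" using ereal_dense2 by blast
    show "\<forall>\<^sub>F n in sequentially. y < - eln (p n) / ereal (real n)"
      using bound[OF c(2)] eventually_ge_at_top[of 1]
    proof eventually_elim
      case (elim n)
      show ?case by (rule less_le_trans[OF c(1) le_neg_eln_div[OF elim]])
    qed
  qed
  then show ?thesis by (simp add: A_def error_exponent_def)
qed

section \<open>Moment measures of the Poisson process\<close>

text \<open>Otherwise \<open>simp\<close> turns \<open>{1..n}\<close> into \<open>{Suc 0..n}\<close>, and facts about \<open>Rn n\<close> no longer match.\<close>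
declare One_nat_def [simp del]

section \<open>Moments of the Poisson distribution as series\<close>

lemma sums_Poisson_mean:
  fixes r :: real
  shows "(\<lambda>m. real m * (r ^ m / fact m * exp (- r))) sums r"
proof -
  have "(\<lambda>m. (r ^ m /\<^sub>R fact m) * (r * exp (- r))) sums (exp r * (r * exp (- r)))"
    by (intro sums_mult2 exp_converges)
  moreover have "real (Suc m) * (r ^ Suc m / fact (Suc m) * exp (- r)) = r ^ m /\<^sub>R fact m * (r * exp (- r))" for m
    by (simp add: field_simps del: of_nat_Suc)
  ultimately have "(\<lambda>m. real (Suc m) * (r ^ Suc m / fact (Suc m) * exp (- r))) sums r"
    by (simp add: exp_minus_inverse mult.left_commute del: of_nat_Suc power_Suc fact_Suc)
  from sums_Suc[OF this] show ?thesis by simp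
qed

text \<open>Shifting the index cancels a factor of the factorial: the term at \<open>m + 1\<close>
  is \<open>r\<close> times the \<open>m\<close>-th term of the mean. Truncated subtraction at
  \<open>m = 0\<close> is harmless because of the factor \<open>m\<close>.\<close>

lemma sums_Poisson_factorial_moment:
  fixes r :: real
  shows "(\<lambda>m. real (m * (m - 1)) * (r ^ m / fact m * exp (- r))) sums r\<^sup>2"
proof -
  have "(\<lambda>m. real m * (r ^ m / fact m * exp (- r)) * r) sums (r * r)"
    by (intro sums_mult2 sums_Poisson_mean)
  moreover have "real (Suc m * (Suc m - 1)) * (r ^ Suc m / fact (Suc m) * exp (- r))
      = real m * (r ^ m / fact m * exp (- r)) * r" for m
  proof -
    have "real (Suc m * (Suc m - 1)) = real (Suc m) * real m" by (simp only: of_nat_mult diff_Suc_1)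
    then show ?thesis by (simp add: field_simps del: of_nat_Suc of_nat_mult)
  qed
  ultimately have "(\<lambda>m. real (Suc m * (Suc m - 1)) * (r ^ Suc m / fact (Suc m) * exp (- r))) sums (r * r)"
    by (simp del: of_nat_Suc power_Suc fact_Suc)
  from sums_Suc[OF this] show ?thesis by (simp add: power2_eq_square)
qed

section \<open>Lebesgue measure on \<open>Rn n\<close>\<close>

lemma product_sigma_finite_lborel: "product_sigma_finite (\<lambda>_::nat. lborel :: real measure)"
  by (simp add: product_sigma_finite_def sigma_finite_lborel)

lemmas sigma_finite_Rn = product_sigma_finite.sigma_finite[OF product_sigma_finite_lborel finite_atLeastAtMost]

lemmas emeasure_Rn_PiE = product_sigma_finite.emeasure_PiM[OF product_sigma_finite_lborel finite_atLeastAtMost]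

lemma emeasure_Rn_singleton:
  assumes "x \<in> space (Rn n)" "n \<ge> 1"
  shows "emeasure (Rn n) {x} = 0"
proof -
  have "{x} = (\<Pi>\<^sub>E i\<in>{1..n}. {x i})"
    using assms by (subst PiE_singleton) (auto simp: space_PiM PiE_def)
  then have "emeasure (Rn n) {x} = (\<Prod>i\<in>{1..n}. emeasure lborel {x i})"
    by (simp only:) (rule emeasure_Rn_PiE, simp)
  \<comment> \<open>A null coordinate exists only for \<open>n \<ge> 1\<close>; \<open>Rn 0\<close>
    is a single point of mass 1.\<close>
  also have "\<dots> = 0" using assms(2) by (intro prod_zero bexI[of _ 1]) auto
  finally show ?thesis .
qed

section \<open>Counts and pair counts of a Poisson process\<close>

locale Poisson_points = prob_space P for P :: "'w measure" +
  fixes n :: nat and lam :: real and T :: "nat \<Rightarrow> 'w \<Rightarrow> (nat \<Rightarrow> real)"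
  assumes Poisson: "homogeneous_Poisson P n lam T" and lam: "lam > 0" and n: "n \<ge> 1"
begin

lemma T_measurable [measurable]: "T k \<in> P \<rightarrow>\<^sub>M Rn n"
  using Poisson by (simp add: homogeneous_Poisson_def)

lemma AE_finite:
  assumes "B \<in> sets (Rn n)" "emeasure (Rn n) B < \<infinity>"
  shows "AE \<omega> in P. finite {k. T k \<omega> \<in> B}"
  using Poisson assms unfolding homogeneous_Poisson_def by blast

lemma measure_count_eq:
  assumes "B \<in> sets (Rn n)" "emeasure (Rn n) B < \<infinity>"
  shows "prob {\<omega>\<in>space P. point_count T B \<omega> = m}
    = (lam * measure (Rn n) B) ^ m / fact m * exp (- (lam * measure (Rn n) B))"
  using Poisson assms unfolding homogeneous_Poisson_def by blast

lemma count_indep: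
  fixes B :: "nat \<Rightarrow> (nat \<Rightarrow> real) set"
  assumes "\<And>i. i < m \<Longrightarrow> B i \<in> sets (Rn n)" "\<And>i. i < m \<Longrightarrow> emeasure (Rn n) (B i) < \<infinity>"
    "disjoint_family_on B {..<m}"
  shows "indep_vars (\<lambda>_. count_space UNIV) (\<lambda>i. point_count T (B i)) {..<m}"
  using Poisson assms unfolding homogeneous_Poisson_def by blast

text \<open>Measurability of counts is part of the independence requirement, here applied to a
  family with one member.\<close>

lemma count_measurable [measurable]:
  assumes "B \<in> sets (Rn n)" "emeasure (Rn n) B < \<infinity>"
  shows "point_count T B \<in> P \<rightarrow>\<^sub>M count_space UNIV"
proof -
  have "indep_vars (\<lambda>_. count_space UNIV) (\<lambda>i. point_count T B) {..<1::nat}"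
    by (rule count_indep) (use assms in \<open>auto simp: disjoint_family_on_def\<close>)
  then show ?thesis unfolding indep_vars_def by blast
qed

text \<open>The expectation is summed over the level sets of the count, whose probabilities are the
  Poisson weights. A general \<phi> serves both the mean and the second factorial moment.\<close>

lemma nn_integral_count:
  assumes B: "B \<in> sets (Rn n)" "emeasure (Rn n) B < \<infinity>"
    and \<phi>: "(\<lambda>m. real (\<phi> m) * ((lam * measure (Rn n) B) ^ m / fact m * exp (- (lam * measure (Rn n) B)))) sums s"
  shows "(\<integral>\<^sup>+ \<omega>. of_nat (\<phi> (point_count T B \<omega>)) \<partial>P) = ennreal s"
proof -
  note [measurable] = count_measurable[OF B]
  let ?p = "\<lambda>m. (lam * measure (Rn n) B) ^ m / fact m * exp (- (lam * measure (Rn n) B))"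
  have "of_nat (\<phi> (point_count T B \<omega>))
      = (\<Sum>m. of_nat (\<phi> m) * indicator {\<omega>\<in>space P. point_count T B \<omega> = m} \<omega> :: ennreal)"
    if "\<omega> \<in> space P" for \<omega>
    using that by (subst suminf_cmult_indicator[where i = "point_count T B \<omega>"])
      (auto simp: disjoint_family_on_def)
  then have "(\<integral>\<^sup>+ \<omega>. of_nat (\<phi> (point_count T B \<omega>)) \<partial>P)
      = (\<integral>\<^sup>+ \<omega>. (\<Sum>m. of_nat (\<phi> m) * indicator {\<omega>\<in>space P. point_count T B \<omega> = m} \<omega>) \<partial>P)"
    by (rule nn_integral_cong)
  also have "\<dots> = (\<Sum>m. \<integral>\<^sup>+ \<omega>. of_nat (\<phi> m) * indicator {\<omega>\<in>space P. point_count T B \<omega> = m} \<omega> \<partial>P)"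
    by (rule nn_integral_suminf) measurable
  also have "\<dots> = (\<Sum>m. ennreal (real (\<phi> m) * ?p m))"
  proof (rule suminf_cong)
    fix m
    have "(\<integral>\<^sup>+ \<omega>. of_nat (\<phi> m) * indicator {\<omega>\<in>space P. point_count T B \<omega> = m} \<omega> \<partial>P)
        = of_nat (\<phi> m) * emeasure P {\<omega>\<in>space P. point_count T B \<omega> = m}"
      by (rule nn_integral_cmult_indicator) measurable
    moreover have "emeasure P {\<omega>\<in>space P. point_count T B \<omega> = m} = ennreal (?p m)"
      by (simp only: emeasure_eq_measure measure_count_eq[OF B])
    ultimately show "(\<integral>\<^sup>+ \<omega>. of_nat (\<phi> m) * indicator {\<omega>\<in>space P. point_count T B \<omega> = m} \<omega> \<partial>P)
        = ennreal (real (\<phi> m) * ?p m)"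
      using lam by (simp only: ennreal_of_nat_eq_real_of_nat) (subst ennreal_mult, auto)
  qed
  also have "\<dots> = ennreal s"
  proof (rule sums_unique[symmetric])
    have nonneg: "0 \<le> real (\<phi> m) * ?p m" for m using lam by simp
    moreover have "0 \<le> s" by (rule sums_le[OF nonneg sums_zero \<phi>])
    ultimately show "(\<lambda>m. ennreal (real (\<phi> m) * ?p m)) sums ennreal s"
      using \<phi> by (subst sums_ennreal)
  qed
  finally show ?thesis .
qed

lemma nn_integral_count_mean:
  assumes B: "B \<in> sets (Rn n)" "emeasure (Rn n) B < \<infinity>"
  shows "(\<integral>\<^sup>+ \<omega>. of_nat (point_count T B \<omega>) \<partial>P) = ennreal lam * emeasure (Rn n) B"
  using nn_integral_count[OF B sums_Poisson_mean] B lam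
  by (simp add: ennreal_mult'' emeasure_eq_ennreal_measure less_top)

lemma nn_integral_count_factorial_moment:
  assumes B: "B \<in> sets (Rn n)" "emeasure (Rn n) B < \<infinity>"
  shows "(\<integral>\<^sup>+ \<omega>. of_nat (point_count T B \<omega> * (point_count T B \<omega> - 1)) \<partial>P)
     = (ennreal lam)\<^sup>2 * (emeasure (Rn n) B * emeasure (Rn n) B)"
proof -
  have "emeasure (Rn n) B = ennreal (measure (Rn n) B)"
    using B by (intro emeasure_eq_ennreal_measure) auto
  then show ?thesis
    using nn_integral_count[where \<phi> = "\<lambda>m. m * (m - 1)", OF B sums_Poisson_factorial_moment] lam
    by (simp add: ennreal_mult'' ennreal_power power2_eq_square mult_ac)
qed

lemma nn_integral_count_indep:
  assumes "A \<in> sets (Rn n)" "emeasure (Rn n) A < \<infinity>" "C \<in> sets (Rn n)" "emeasure (Rn n) C < \<infinity>"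
    "A \<inter> C = {}"
  shows "(\<integral>\<^sup>+ \<omega>. of_nat (point_count T A \<omega> * point_count T C \<omega>) \<partial>P)
    = (ennreal lam)\<^sup>2 * (emeasure (Rn n) A * emeasure (Rn n) C)"
proof -
  let ?B = "\<lambda>i::nat. if i = 0 then A else C"
  have "indep_vars (\<lambda>_. count_space UNIV) (\<lambda>i. point_count T (?B i)) {..<2}"
    using assms by (intro count_indep) (auto simp: disjoint_family_on_def)
  then have "indep_vars (\<lambda>_. borel) (\<lambda>i \<omega>. of_nat (point_count T (?B i) \<omega>) :: ennreal) {..<2}"
    by (rule indep_vars_compose2) simp
  then have "(\<integral>\<^sup>+ \<omega>. (\<Prod>i<2. of_nat (point_count T (?B i) \<omega>)) \<partial>P)
      = (\<Prod>i<2. \<integral>\<^sup>+ \<omega>. of_nat (point_count T (?B i) \<omega>) \<partial>P)"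
    by (intro indep_vars_nn_integral) auto
  then show ?thesis
    using assms by (simp add: numeral_2_eq_2 nn_integral_count_mean mult_ac)
qed

text \<open>The second factorial moment measure: the expected number of ordered index pairs, off the
  diagonal, whose points lie in a given set. As a push-forward it is a measure by construction, and
  points with different indices are still allowed to coincide.\<close>

definition pair_intensity :: "((nat \<Rightarrow> real) \<times> (nat \<Rightarrow> real)) measure" where
  "pair_intensity = distr (P \<Otimes>\<^sub>M count_space {p. fst p \<noteq> snd p}) (Rn n \<Otimes>\<^sub>M Rn n)
     (\<lambda>(\<omega>, p). (T (fst p) \<omega>, T (snd p) \<omega>))"

lemma sets_pair_intensity [simp, measurable_cong]:
  "sets pair_intensity = sets (Rn n \<Otimes>\<^sub>M Rn n)"
  by (simp add: pair_intensity_def)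

lemma T_pair_measurable [measurable]:
  "(\<lambda>(\<omega>, p). (T (fst p) \<omega>, T (snd p) \<omega>)) \<in> (P \<Otimes>\<^sub>M count_space {p. fst p \<noteq> snd p}) \<rightarrow>\<^sub>M (Rn n \<Otimes>\<^sub>M Rn n)"
proof -
  have "(\<lambda>x. T (g (snd x)) (fst x)) \<in> (P \<Otimes>\<^sub>M count_space {p. fst p \<noteq> snd p}) \<rightarrow>\<^sub>M Rn n" for g :: "nat \<times> nat \<Rightarrow> nat"
  proof (rule measurable_compose_countable'[where g = snd and I = "{p. fst p \<noteq> snd p}"])
    show "(\<lambda>x. T (g p) (fst x)) \<in> (P \<Otimes>\<^sub>M count_space {p. fst p \<noteq> snd p}) \<rightarrow>\<^sub>M Rn n" for p
      by (rule measurable_compose[OF measurable_fst T_measurable])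
  qed auto
  then show ?thesis by (simp add: case_prod_beta)
qed

lemma emeasure_pair_intensity:
  assumes [measurable]: "S \<in> sets (Rn n \<Otimes>\<^sub>M Rn n)"
  shows "emeasure pair_intensity S
    = (\<integral>\<^sup>+ \<omega>. \<integral>\<^sup>+ p. indicator S (T (fst p) \<omega>, T (snd p) \<omega>) \<partial>count_space {p. fst p \<noteq> snd p} \<partial>P)"
proof -
  interpret C: sigma_finite_measure "count_space {p::nat \<times> nat. fst p \<noteq> snd p}"
    by (rule sigma_finite_measure_count_space_countable) auto
  have "emeasure pair_intensity S = (\<integral>\<^sup>+ z. indicator S z \<partial>pair_intensity)"
    using assms by (simp add: nn_integral_indicator)
  also have "\<dots> = (\<integral>\<^sup>+ x. indicator S (case x of (\<omega>, p) \<Rightarrow> (T (fst p) \<omega>, T (snd p) \<omega>))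
      \<partial>(P \<Otimes>\<^sub>M count_space {p. fst p \<noteq> snd p}))"
    unfolding pair_intensity_def by (rule nn_integral_distr) measurable
  also have "\<dots> = (\<integral>\<^sup>+ \<omega>. \<integral>\<^sup>+ p. indicator S (T (fst p) \<omega>, T (snd p) \<omega>) \<partial>count_space {p. fst p \<noteq> snd p} \<partial>P)"
    by (subst C.nn_integral_fst[symmetric]) auto
  finally show ?thesis .
qed

text \<open>Cardinality defaults to 0 on infinite sets, so almost sure finiteness of both index sets
  is used to express the number of pairs by \<open>card\<close>.\<close>

lemma emeasure_pair_intensity_card:
  assumes "A \<in> sets (Rn n)" "emeasure (Rn n) A < \<infinity>" "C \<in> sets (Rn n)" "emeasure (Rn n) C < \<infinity>"
  shows "emeasure pair_intensity (A \<times> C)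
    = (\<integral>\<^sup>+ \<omega>. of_nat (card ({k. T k \<omega> \<in> A} \<times> {k. T k \<omega> \<in> C} - Id)) \<partial>P)"
proof -
  have "AE \<omega> in P. finite {k. T k \<omega> \<in> A} \<and> finite {k. T k \<omega> \<in> C}"
    using assms AE_finite by auto
  then have "(\<integral>\<^sup>+ \<omega>. \<integral>\<^sup>+ p. indicator (A \<times> C) (T (fst p) \<omega>, T (snd p) \<omega>) \<partial>count_space {p. fst p \<noteq> snd p} \<partial>P)
    = (\<integral>\<^sup>+ \<omega>. of_nat (card ({k. T k \<omega> \<in> A} \<times> {k. T k \<omega> \<in> C} - Id)) \<partial>P)"
  proof (intro nn_integral_cong_AE, eventually_elim)
    case (elim \<omega>)
    let ?S = "{k. T k \<omega> \<in> A} \<times> {k. T k \<omega> \<in> C} - Id"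
    have "(\<integral>\<^sup>+ p. indicator (A \<times> C) (T (fst p) \<omega>, T (snd p) \<omega>) \<partial>count_space {p. fst p \<noteq> snd p})
        = (\<integral>\<^sup>+ p. indicator ?S p \<partial>count_space {p. fst p \<noteq> snd p})"
      by (intro nn_integral_cong) (auto split: split_indicator)
    also have "\<dots> = emeasure (count_space {p. fst p \<noteq> snd p}) ?S"
      by (rule nn_integral_indicator) auto
    also have "\<dots> = of_nat (card ?S)"
      using elim by (subst emeasure_count_space_finite) auto
    finally show ?case .
  qed
  then show ?thesis using assms by (simp add: emeasure_pair_intensity)
qed

lemma emeasure_pair_intensity_disjoint:
  assumes "A \<in> sets (Rn n)" "emeasure (Rn n) A < \<infinity>" "C \<in> sets (Rn n)" "emeasure (Rn n) C < \<infinity>"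
    "A \<inter> C = {}"
  shows "emeasure pair_intensity (A \<times> C) = (ennreal lam)\<^sup>2 * (emeasure (Rn n) A * emeasure (Rn n) C)"
proof -
  have "{k. T k \<omega> \<in> A} \<times> {k. T k \<omega> \<in> C} - Id = {k. T k \<omega> \<in> A} \<times> {k. T k \<omega> \<in> C}" for \<omega>
    using assms(5) by auto
  then show ?thesis
    using emeasure_pair_intensity_card[OF assms(1-4)] nn_integral_count_indep[OF assms]
    by (simp add: point_count_def card_cartesian_product)
qed

text \<open>A set of \<open>m\<close> indices has \<open>m * (m - 1)\<close> ordered pairs off the
  diagonal, so this is the second factorial moment of a Poisson count.\<close>

lemma emeasure_pair_intensity_square:
  assumes B: "B \<in> sets (Rn n)" "emeasure (Rn n) B < \<infinity>"
  shows "emeasure pair_intensity (B \<times> B) = (ennreal lam)\<^sup>2 * (emeasure (Rn n) B * emeasure (Rn n) B)"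
proof -
  have "card (K \<times> K - Id) = card K * (card K - 1)" if "finite K" for K :: "nat set"
  proof -
    have "K \<times> K - Id = K \<times> K - (\<lambda>k. (k, k)) ` K" by auto
    then have "card (K \<times> K - Id) = card K * card K - card K"
      using that by (simp add: card_Diff_subset card_image inj_on_def image_subset_iff card_cartesian_product)
    then show ?thesis by (simp add: diff_mult_distrib2)
  qed
  with AE_finite[OF B] have "emeasure pair_intensity (B \<times> B)
    = (\<integral>\<^sup>+ \<omega>. of_nat (point_count T B \<omega> * (point_count T B \<omega> - 1)) \<partial>P)"
    unfolding emeasure_pair_intensity_card[OF B B] point_count_def
    by (intro nn_integral_cong_AE) auto
  then show ?thesis by (simp only: nn_integral_count_factorial_moment[OF B])
qed

text \<open>Overlapping sides reduce to the disjoint and square cases: the rectangle splits into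
  \<open>(A - C) \<times> C\<close>, \<open>(A \<inter> C) \<times> (C - A)\<close> and the square
  of \<open>A \<inter> C\<close>.\<close>

lemma emeasure_pair_intensity_finite:
  assumes A: "A \<in> sets (Rn n)" "emeasure (Rn n) A < \<infinity>" and C: "C \<in> sets (Rn n)" "emeasure (Rn n) C < \<infinity>"
  shows "emeasure pair_intensity (A \<times> C) = (ennreal lam)\<^sup>2 * (emeasure (Rn n) A * emeasure (Rn n) C)"
proof -
  let ?e = "emeasure (Rn n)"
  note [measurable] = A(1) C(1)
  have fin: "?e (A - C) < \<infinity>" "?e (A \<inter> C) < \<infinity>" "?e (C - A) < \<infinity>"
    using le_less_trans[OF emeasure_mono A(2), of "A - C"] le_less_trans[OF emeasure_mono A(2), of "A \<inter> C"]
      le_less_trans[OF emeasure_mono C(2), of "C - A"] A(1) C(1) by blast+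
  have rect: "X \<times> Y \<in> sets pair_intensity" if "X \<in> sets (Rn n)" "Y \<in> sets (Rn n)" for X Y
    using that by simp
  have a: "?e A = ?e (A - C) + ?e (A \<inter> C)"
    using plus_emeasure[of "A - C" "Rn n" "A \<inter> C"] A C by (simp add: Un_Diff_Int Diff_Int_distrib2)
  have c: "?e C = ?e (C - A) + ?e (A \<inter> C)"
    using plus_emeasure[of "C - A" "Rn n" "C \<inter> A"] A C
    by (simp add: Un_Diff_Int Diff_Int_distrib2 Int_commute[of A])
  have "A \<times> C = (A - C) \<times> C \<union> ((A \<inter> C) \<times> (C - A) \<union> (A \<inter> C) \<times> (A \<inter> C))" by auto
  also have "emeasure pair_intensity \<dots> = emeasure pair_intensity ((A - C) \<times> C)
      + (emeasure pair_intensity ((A \<inter> C) \<times> (C - A)) + emeasure pair_intensity ((A \<inter> C) \<times> (A \<inter> C)))"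
  proof -
    have "emeasure pair_intensity ((A \<inter> C) \<times> (C - A)) + emeasure pair_intensity ((A \<inter> C) \<times> (A \<inter> C))
        = emeasure pair_intensity ((A \<inter> C) \<times> (C - A) \<union> (A \<inter> C) \<times> (A \<inter> C))"
      using A C by (intro plus_emeasure rect sets.Un sets.Int sets.Diff) auto
    moreover have "emeasure pair_intensity ((A - C) \<times> C)
        + emeasure pair_intensity ((A \<inter> C) \<times> (C - A) \<union> (A \<inter> C) \<times> (A \<inter> C))
        = emeasure pair_intensity ((A - C) \<times> C \<union> ((A \<inter> C) \<times> (C - A) \<union> (A \<inter> C) \<times> (A \<inter> C)))"
      using A C by (intro plus_emeasure rect sets.Un sets.Int sets.Diff) auto
    ultimately show ?thesis by simp
  qed
  also have "\<dots> = (ennreal lam)\<^sup>2 * (?e (A - C) * ?e C)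
      + ((ennreal lam)\<^sup>2 * (?e (A \<inter> C) * ?e (C - A)) + (ennreal lam)\<^sup>2 * (?e (A \<inter> C) * ?e (A \<inter> C)))"
  proof -
    have "emeasure pair_intensity ((A - C) \<times> C) = (ennreal lam)\<^sup>2 * (?e (A - C) * ?e C)"
      by (rule emeasure_pair_intensity_disjoint[OF _ fin(1) C]) auto
    moreover have "emeasure pair_intensity ((A \<inter> C) \<times> (C - A)) = (ennreal lam)\<^sup>2 * (?e (A \<inter> C) * ?e (C - A))"
      by (rule emeasure_pair_intensity_disjoint[OF _ fin(2) _ fin(3)]) auto
    moreover have "emeasure pair_intensity ((A \<inter> C) \<times> (A \<inter> C)) = (ennreal lam)\<^sup>2 * (?e (A \<inter> C) * ?e (A \<inter> C))"
      by (rule emeasure_pair_intensity_square[OF _ fin(2)]) auto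
    ultimately show ?thesis by simp
  qed
  also have "\<dots> = (ennreal lam)\<^sup>2 * (?e A * ?e C)"
    unfolding a c by (simp add: algebra_simps)
  finally show ?thesis .
qed

text \<open>Both sides are cut along a countable partition into pieces of finite volume, and
  countable additivity sums the pieces.\<close>

lemma emeasure_pair_intensity_times:
  assumes A: "A \<in> sets (Rn n)" and C: "C \<in> sets (Rn n)"
  shows "emeasure pair_intensity (A \<times> C) = (ennreal lam)\<^sup>2 * (emeasure (Rn n) A * emeasure (Rn n) C)"
proof -
  let ?e = "emeasure (Rn n)"
  note [measurable] = A C
  interpret sigma_finite_measure "Rn n" by (rule sigma_finite_Rn)
  obtain F :: "nat \<Rightarrow> (nat \<Rightarrow> real) set" where F: "range F \<subseteq> sets (Rn n)" "(\<Union>i. F i) = space (Rn n)"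
    "\<And>i. ?e (F i) \<noteq> \<infinity>" "disjoint_family F"
    by (rule sigma_finite_disjoint) (rule that)
  have [measurable]: "F i \<in> sets (Rn n)" for i using F(1) by auto
  have fin: "?e (B \<inter> F i) < \<infinity>" for B i
  proof -
    have "?e (B \<inter> F i) \<le> ?e (F i)" by (rule emeasure_mono) auto
    also have "\<dots> < \<infinity>" using F(3)[of i] by (simp add: less_top)
    finally show ?thesis .
  qed
  have split: "?e B = (\<Sum>i. ?e (B \<inter> F i))" if [measurable]: "B \<in> sets (Rn n)" for B
  proof -
    have "disjoint_family (\<lambda>i. B \<inter> F i)" using F(4) by (auto simp: disjoint_family_on_def)
    moreover have "(\<Union>i. B \<inter> F i) = B" using F(2) sets.sets_into_space[OF that] by auto
    ultimately show ?thesis using suminf_emeasure[of "\<lambda>i. B \<inter> F i" "Rn n"] by (auto simp: image_subset_iff)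
  qed
  have "emeasure pair_intensity (A \<times> C) = (\<Sum>i. emeasure pair_intensity ((A \<inter> F i) \<times> C))"
  proof -
    have "disjoint_family (\<lambda>i. (A \<inter> F i) \<times> C)" using F(4) by (auto simp: disjoint_family_on_def)
    moreover have "(\<Union>i. (A \<inter> F i) \<times> C) = A \<times> C" using F(2) sets.sets_into_space[OF A] by auto
    ultimately show ?thesis
      using suminf_emeasure[of "\<lambda>i. (A \<inter> F i) \<times> C" pair_intensity] by (auto simp: image_subset_iff)
  qed
  also have "\<dots> = (\<Sum>i. \<Sum>j. emeasure pair_intensity ((A \<inter> F i) \<times> (C \<inter> F j)))"
  proof (rule suminf_cong)
    fix i
    have "disjoint_family (\<lambda>j. (A \<inter> F i) \<times> (C \<inter> F j))" using F(4) by (auto simp: disjoint_family_on_def)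
    moreover have "(\<Union>j. (A \<inter> F i) \<times> (C \<inter> F j)) = (A \<inter> F i) \<times> C"
      using F(2) sets.sets_into_space[OF C] by auto
    ultimately show "emeasure pair_intensity ((A \<inter> F i) \<times> C)
        = (\<Sum>j. emeasure pair_intensity ((A \<inter> F i) \<times> (C \<inter> F j)))"
      using suminf_emeasure[of "\<lambda>j. (A \<inter> F i) \<times> (C \<inter> F j)" pair_intensity] by (auto simp: image_subset_iff)
  qed
  also have "\<dots> = (\<Sum>i. \<Sum>j. (ennreal lam)\<^sup>2 * (?e (A \<inter> F i) * ?e (C \<inter> F j)))"
    using fin by (intro suminf_cong emeasure_pair_intensity_finite) auto
  also have "\<dots> = (ennreal lam)\<^sup>2 * (?e A * ?e C)"
    by (simp add: split[OF A] split[OF C] ennreal_suminf_cmult ennreal_suminf_multc)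
  finally show ?thesis .
qed

lemma pair_intensity_eq:
  assumes S: "S \<in> sets (Rn n \<Otimes>\<^sub>M Rn n)"
  shows "emeasure pair_intensity S = (ennreal lam)\<^sup>2 * emeasure (Rn n \<Otimes>\<^sub>M Rn n) S"
proof -
  \<comment> \<open>Uniqueness of a measure with given values on rectangles is used for the product
    measure itself, so \<open>pair_intensity\<close> is rescaled first; \<open>lam > 0\<close> makes
    the scaling invertible.\<close>
  let ?c = "ennreal (1 / lam\<^sup>2)"
  have c: "?c * (ennreal lam)\<^sup>2 = 1" "(ennreal lam)\<^sup>2 * ?c = 1"
    using lam by (simp_all add: ennreal_power ennreal_mult[symmetric])
  have "Rn n \<Otimes>\<^sub>M Rn n = scale_measure ?c pair_intensity"
  proof (rule pair_measure_eqI[OF sigma_finite_Rn sigma_finite_Rn])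
    fix A C assume "A \<in> sets (Rn n)" "C \<in> sets (Rn n)"
    then show "emeasure (Rn n) A * emeasure (Rn n) C = emeasure (scale_measure ?c pair_intensity) (A \<times> C)"
      by (simp add: emeasure_pair_intensity_times mult.assoc[symmetric] c)
  qed simp
  then show ?thesis by (simp add: mult.assoc[symmetric] c)
qed

text \<open>The enumeration could a priori repeat a point. By \<open>pair_intensity_eq\<close> the
  mean number of coinciding pairs is proportional to the volume of the diagonal, which is 0 because
  singletons are null for \<open>n \<ge> 1\<close>.\<close>

lemma AE_distinct_points: "AE \<omega> in P. \<forall>k j. k \<noteq> j \<longrightarrow> T k \<omega> \<noteq> T j \<omega>"
proof -
  interpret sigma_finite_measure "Rn n" by (rule sigma_finite_Rn)
  define \<Delta> where "\<Delta> = {z \<in> space (Rn n \<Otimes>\<^sub>M Rn n). \<forall>i\<in>{1..n}. fst z i = snd z i}"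
  have [measurable]: "\<Delta> \<in> sets (Rn n \<Otimes>\<^sub>M Rn n)"
    unfolding \<Delta>_def
  proof (intro sets.sets_Collect_finite_All')
    fix i assume "i \<in> {1..n}"
    then have [measurable]: "(\<lambda>x. x i) \<in> borel_measurable (Rn n)"
      using measurable_component_singleton[of i "{1..n}" "\<lambda>_. lborel :: real measure"] by simp
    show "{z \<in> space (Rn n \<Otimes>\<^sub>M Rn n). fst z i = snd z i} \<in> sets (Rn n \<Otimes>\<^sub>M Rn n)" by measurable
  qed (use n in auto)
  have "emeasure (Rn n \<Otimes>\<^sub>M Rn n) \<Delta> = (\<integral>\<^sup>+ x. emeasure (Rn n) (Pair x -` \<Delta>) \<partial>Rn n)"
    by (rule emeasure_pair_measure_alt) measurable
  also have "\<dots> = (\<integral>\<^sup>+ x. 0 \<partial>Rn n)"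
  proof (rule nn_integral_cong)
    fix x assume x: "x \<in> space (Rn n)"
    have "y = x" if "(x, y) \<in> \<Delta>" for y
      using that by (auto simp: \<Delta>_def space_pair_measure space_PiM intro: PiE_ext)
    then have "Pair x -` \<Delta> = {x}" using x by (auto simp: \<Delta>_def space_pair_measure)
    then show "emeasure (Rn n) (Pair x -` \<Delta>) = 0" using x n by (simp add: emeasure_Rn_singleton)
  qed
  finally have "emeasure pair_intensity \<Delta> = 0" by (simp add: pair_intensity_eq)
  then have "AE z in pair_intensity. z \<notin> \<Delta>" by (intro AE_not_in) (simp add: null_setsI)
  then have AE_prod: "AE x in P \<Otimes>\<^sub>M count_space {p. fst p \<noteq> snd p}. (case x of (\<omega>, p) \<Rightarrow> (T (fst p) \<omega>, T (snd p) \<omega>)) \<notin> \<Delta>"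
    unfolding pair_intensity_def by (subst (asm) AE_distr_iff) auto
  then have "AE \<omega> in P. AE p in count_space {p. fst p \<noteq> snd p}. (T (fst p) \<omega>, T (snd p) \<omega>) \<notin> \<Delta>"
  proof -
    interpret C: sigma_finite_measure "count_space {p::nat \<times> nat. fst p \<noteq> snd p}"
      by (rule sigma_finite_measure_count_space_countable) auto
    interpret pair_sigma_finite P "count_space {p::nat \<times> nat. fst p \<noteq> snd p}" ..
    show ?thesis using AE_pair[OF AE_prod] by simp
  qed
  then show ?thesis
    using AE_space
  proof eventually_elim
    case (elim \<omega>)
    show ?case
    proof (intro allI impI)
      fix k j :: nat assume "k \<noteq> j"
      then have "(T k \<omega>, T j \<omega>) \<notin> \<Delta>" using elim(1) by (auto simp: AE_count_space)
      moreover have "T k \<omega> \<in> space (Rn n)" for k using measurable_space[OF T_measurable elim(2)] .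
      ultimately show "T k \<omega> \<noteq> T j \<omega>" by (auto simp: \<Delta>_def space_pair_measure)
    qed
  qed
qed

lemma intensity_eq: "intensity P n T = ennreal lam"
proof -
  have cube: "unit_cube n \<in> sets (Rn n)" "emeasure (Rn n) (unit_cube n) = 1"
    by (simp_all add: unit_cube_def emeasure_Rn_PiE[simplified])
  have "intensity P n T = (\<integral>\<^sup>+ \<omega>. of_nat (point_count T (unit_cube n) \<omega>) \<partial>P)"
    unfolding intensity_def
  proof (intro nn_integral_cong_AE)
    show "AE \<omega> in P. (\<Sum>k. indicator (unit_cube n) (T k \<omega>)) = (of_nat (point_count T (unit_cube n) \<omega>) :: ennreal)"
      using AE_finite[OF cube(1)] cube(2)
    proof (simp, elim AE_mp, intro AE_I2 impI)
      fix \<omega> assume fin: "finite {k. T k \<omega> \<in> unit_cube n}"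
      have "(\<Sum>k. indicator (unit_cube n) (T k \<omega>)) = (\<Sum>k\<in>{k. T k \<omega> \<in> unit_cube n}. 1 :: ennreal)"
        using fin by (subst suminf_finite[where N = "{k. T k \<omega> \<in> unit_cube n}"]) auto
      then show "(\<Sum>k. indicator (unit_cube n) (T k \<omega>)) = (of_nat (point_count T (unit_cube n) \<omega>) :: ennreal)"
        by (simp add: point_count_def)
    qed
  qed
  also have "\<dots> = ennreal lam"
    using nn_integral_count_mean[OF cube(1)] cube(2) by simp
  finally show ?thesis .
qed

end

section \<open>The error probability in a fixed dimension\<close>

lemma measurable_vdiff [measurable (raw)]:
  assumes "g \<in> M \<rightarrow>\<^sub>M Rn n" "h \<in> M \<rightarrow>\<^sub>M Rn n"
  shows "(\<lambda>x. vdiff n (g x) (h x)) \<in> M \<rightarrow>\<^sub>M Rn n"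
  unfolding vdiff_def
proof (rule measurable_restrict)
  fix i assume i: "i \<in> {1..n}"
  have [measurable]: "(\<lambda>x. g x i) \<in> borel_measurable M" "(\<lambda>x. h x i) \<in> borel_measurable M"
    using measurable_compose[OF assms(1) measurable_component_singleton[OF i]]
      measurable_compose[OF assms(2) measurable_component_singleton[OF i]] by simp_all
  show "(\<lambda>x. g x i - h x i) \<in> M \<rightarrow>\<^sub>M lborel" by simp
qed

lemma vdiff_in_space [simp]: "vdiff n s t \<in> space (Rn n)"
  by (auto simp: vdiff_def space_PiM)

lemma measurable_reflection: "vdiff n c \<in> Rn n \<rightarrow>\<^sub>M Rn n"
  unfolding vdiff_def
proof (rule measurable_restrict)
  fix i assume i: "i \<in> {1..n}"
  have [measurable]: "(\<lambda>x. x i) \<in> borel_measurable (Rn n)"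
    using measurable_component_singleton[OF i, of "\<lambda>_. lborel :: real measure"] by simp
  show "(\<lambda>x. c i - x i) \<in> Rn n \<rightarrow>\<^sub>M lborel" by simp
qed

lemma emeasure_lborel_reflection:
  fixes c :: real
  assumes [measurable]: "A \<in> sets borel"
  shows "emeasure lborel ((\<lambda>y. c - y) -` A) = emeasure lborel A"
proof -
  have eq: "(lborel :: real measure) = density (distr lborel borel (\<lambda>x. c + (-1) * x)) (\<lambda>_. 1)"
    using lborel_real_affine[of "-1" c] by simp
  have "emeasure lborel A = emeasure (distr lborel borel (\<lambda>x. c + (-1) * x)) A"
    by (subst eq) (simp add: density_1)
  also have "\<dots> = emeasure lborel ((\<lambda>y. c - y) -` A)"
    by (subst emeasure_distr) auto
  finally show ?thesis ..
qed

text \<open>Each coordinate undergoes an affine map of slope -1, which preserves Lebesgue measure,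
  and rectangles determine the product measure.\<close>

lemma distr_reflection: "distr (Rn n) (Rn n) (vdiff n c) = Rn n"
proof (rule product_sigma_finite.PiM_eqI[OF product_sigma_finite_lborel])
  fix A assume A: "\<And>i. i \<in> {1..n} \<Longrightarrow> A i \<in> sets (lborel :: real measure)"
  have "emeasure (distr (Rn n) (Rn n) (vdiff n c)) (Pi\<^sub>E {1..n} A)
      = emeasure (Rn n) (vdiff n c -` Pi\<^sub>E {1..n} A \<inter> space (Rn n))"
    using A by (intro emeasure_distr measurable_reflection sets_PiM_I_finite) auto
  also have "vdiff n c -` Pi\<^sub>E {1..n} A \<inter> space (Rn n) = Pi\<^sub>E {1..n} (\<lambda>i. (\<lambda>y. c i - y) -` A i)"
    by (auto simp: vdiff_def space_PiM PiE_iff)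
  also have "emeasure (Rn n) \<dots> = (\<Prod>i\<in>{1..n}. emeasure lborel ((\<lambda>y. c i - y) -` A i))"
  proof (rule emeasure_Rn_PiE)
    fix i assume "i \<in> {1..n}"
    from A[OF this] have [measurable]: "A i \<in> sets borel" by simp
    have "(\<lambda>y. c i - y) -` A i \<inter> space borel \<in> sets borel" by measurable
    then show "(\<lambda>y. c i - y) -` A i \<in> sets lborel" by simp
  qed
  also have "\<dots> = (\<Prod>i\<in>{1..n}. emeasure lborel (A i))"
    using A by (intro prod.cong emeasure_lborel_reflection) auto
  finally show "emeasure (distr (Rn n) (Rn n) (vdiff n c)) (Pi\<^sub>E {1..n} A)
      = (\<Prod>i\<in>{1..n}. emeasure lborel (A i))" .
qed auto

lemma emeasure_reflection:
  assumes "A \<in> sets (Rn n)"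
  shows "emeasure (Rn n) {y \<in> space (Rn n). vdiff n c y \<in> A} = emeasure (Rn n) A"
proof -
  have "emeasure (Rn n) A = emeasure (distr (Rn n) (Rn n) (vdiff n c)) A"
    by (simp only: distr_reflection)
  also have "\<dots> = emeasure (Rn n) (vdiff n c -` A \<inter> space (Rn n))"
    by (rule emeasure_distr[OF measurable_reflection assms])
  also have "vdiff n c -` A \<inter> space (Rn n) = {y \<in> space (Rn n). vdiff n c y \<in> A}" by auto
  finally show ?thesis ..
qed

text \<open>For fixed \<open>d\<close> and \<open>x\<close> this makes the condition on
  \<open>y\<close> a reflection, so that \<open>emeasure_reflection\<close> applies. The sum
  \<open>\<lambda>i. d i + x i\<close> is read only on \<open>{1..n}\<close> and need not be a point
  of \<open>Rn n\<close>.\<close>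

lemma vdiff_vdiff: "vdiff n d (vdiff n y x) = vdiff n (\<lambda>i. d i + x i) y"
  by (auto simp: vdiff_def)

lemma vdiff_eq_vorigin_iff:
  assumes "s \<in> space (Rn n)" "t \<in> space (Rn n)"
  shows "vdiff n s t = vorigin n \<longleftrightarrow> s = t"
proof
  assume eq: "vdiff n s t = vorigin n"
  have "s i = t i" if "i \<in> {1..n}" for i
    using fun_cong[OF eq, of i] that by (simp add: vdiff_def vorigin_def)
  then show "s = t" using assms by (auto simp: space_PiM intro: PiE_ext)
qed (auto simp: vdiff_def vorigin_def)

lemma vdiff_vorigin: "d \<in> space (Rn n) \<Longrightarrow> vdiff n d (vorigin n) = d"
  by (auto simp: vdiff_def vorigin_def space_PiM PiE_iff extensional_def fun_eq_iff)

lemma nn_integral_count_space_off_diagonal: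
  fixes g :: "nat \<times> nat \<Rightarrow> ennreal"
  shows "(\<integral>\<^sup>+ p. g p \<partial>count_space {p. fst p \<noteq> snd p}) = (\<Sum>k. \<Sum>j. if j = k then 0 else g (k, j))"
proof -
  have "(\<integral>\<^sup>+ p. g p \<partial>count_space {p. fst p \<noteq> snd p})
      = (\<integral>\<^sup>+ p. g p * indicator {p. fst p \<noteq> snd p} p \<partial>count_space UNIV)"
    by (simp add: nn_integral_count_space_indicator)
  also have "\<dots> = (\<Sum>k. \<Sum>j. g (k, j) * indicator {p. fst p \<noteq> snd p} (k, j))"
    by (simp only: nn_integral_fst_count_space[symmetric] nn_integral_count_space_nat)
  also have "\<dots> = (\<Sum>k. \<Sum>j. if j = k then 0 else g (k, j))"
    by (intro suminf_cong) auto
  finally show ?thesis .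
qed

section \<open>Decoding errors and superlevel sets of the density\<close>

definition superlevel :: "nat \<Rightarrow> ((nat \<Rightarrow> real) \<Rightarrow> real) \<Rightarrow> (nat \<Rightarrow> real) \<Rightarrow> (nat \<Rightarrow> real) set" where
  "superlevel n f d = {z \<in> space (Rn n). exp (- 1) * f d \<le> f z}"

text \<open>Adding \<open>1 / n\<close> to the bound on the infimum makes it strict and so selects
  an actual competitor. Since \<open>ml_dist\<close> is a negative logarithm divided by
  \<open>n\<close>, this costs the factor \<open>exp (- 1)\<close> in the density.\<close>

lemma not_strict_minimizer_origin:
  assumes d: "d \<in> space (Rn n)" "f d > 0" and n: "n \<ge> 1"
    and not_min: "\<not> strict_minimizer n f \<Phi> d (vorigin n)"
  obtains s where "s \<in> \<Phi>" "s \<noteq> vorigin n" "vdiff n d s \<in> superlevel n f d"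
proof -
  have "(INF s\<in>\<Phi> - {vorigin n}. ml_dist n f d s) \<le> ml_dist n f d (vorigin n)"
    using not_min by (simp add: strict_minimizer_def not_less)
  also have "\<dots> = ereal (- ln (f d) / n)"
    using d n by (simp add: ml_dist_def vdiff_vorigin eln_def)
  also have "\<dots> < ereal ((1 - ln (f d)) / n)"
    using n by (simp add: field_simps)
  finally obtain s where s: "s \<in> \<Phi>" "s \<noteq> vorigin n" "ml_dist n f d s < ereal ((1 - ln (f d)) / n)"
    by (auto simp: INF_less_iff)
  \<comment> \<open>A vanishing density means infinite \<open>ml_dist\<close>; this is excluded
    before \<open>ln\<close> is applied, since \<open>ln 0\<close> is only a default value.\<close>
  have pos: "f (vdiff n d s) > 0"
  proof (rule ccontr)
    assume "\<not> f (vdiff n d s) > 0"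
    then have "ml_dist n f d s = \<infinity>" using n by (simp add: ml_dist_def eln_def ennreal_neg)
    then show False using s(3) by simp
  qed
  then have "- ln (f (vdiff n d s)) / n < (1 - ln (f d)) / n"
    using s(3) n by (simp add: ml_dist_def eln_def)
  then have "- 1 + ln (f d) \<le> ln (f (vdiff n d s))"
    using n by (simp add: field_simps)
  then have "exp (- 1 + ln (f d)) \<le> f (vdiff n d s)"
    using pos by (simp add: ln_ge_iff)
  then have "exp (- 1) * f d \<le> f (vdiff n d s)"
    using d(2) by (simp only: exp_add exp_ln)
  then show ?thesis using s that by (auto simp: superlevel_def)
qed

section \<open>Poisson points with independent marks\<close>

locale marked_Poisson_points = Poisson_points P n lam T for P :: "'w measure" and n lam T +
  fixes D :: "nat \<Rightarrow> 'w \<Rightarrow> (nat \<Rightarrow> real)" and f :: "(nat \<Rightarrow> real) \<Rightarrow> real" and Q :: "(nat \<Rightarrow> real) measure"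
  assumes marks: "iid_marks P n Q T D"
    and f_measurable [measurable]: "f \<in> borel_measurable (Rn n)"
    and Q_def: "Q = density (Rn n) (\<lambda>x. ennreal (f x))"
begin

lemma sets_Q [simp, measurable_cong]: "sets Q = sets (Rn n)"
  by (simp add: Q_def)

lemma indep_marks:
  "indep_var (Pi\<^sub>M UNIV (\<lambda>_. Rn n)) (\<lambda>\<omega> k. T k \<omega>) (Pi\<^sub>M UNIV (\<lambda>_. Rn n)) (\<lambda>\<omega> k. D k \<omega>)"
  using marks by (simp add: iid_marks_def)

lemma T_seq_measurable [measurable]: "(\<lambda>\<omega> j. T j \<omega>) \<in> P \<rightarrow>\<^sub>M Pi\<^sub>M UNIV (\<lambda>_. Rn n)"
  using indep_var_rv1[OF indep_marks] .

lemma D_seq_measurable [measurable]: "(\<lambda>\<omega> j. D j \<omega>) \<in> P \<rightarrow>\<^sub>M Pi\<^sub>M UNIV (\<lambda>_. Rn n)"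
  using indep_var_rv2[OF indep_marks] .

lemma D_measurable [measurable]: "D k \<in> P \<rightarrow>\<^sub>M Rn n"
  using measurable_compose[OF D_seq_measurable measurable_component_singleton[of k]] by simp

lemma distr_D: "distr P (Rn n) (D k) = Q"
  using marks by (simp add: iid_marks_def)

text \<open>Independence makes the joint law of points and marks a product, so the mark can be
  frozen while the points are integrated; \<open>H\<close> may depend on the whole point sequence,
  including \<open>T k\<close>.\<close>

lemma nn_integral_point_mark:
  assumes H: "H \<in> borel_measurable (Pi\<^sub>M UNIV (\<lambda>_. Rn n) \<Otimes>\<^sub>M Rn n)"
  shows "(\<integral>\<^sup>+ \<omega>. H (\<lambda>j. T j \<omega>, D k \<omega>) \<partial>P) = (\<integral>\<^sup>+ d. \<integral>\<^sup>+ \<omega>. H (\<lambda>j. T j \<omega>, d) \<partial>P \<partial>Q)"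
proof -
  let ?M = "Pi\<^sub>M UNIV (\<lambda>_. Rn n) :: (nat \<Rightarrow> nat \<Rightarrow> real) measure"
  let ?T = "distr P ?M (\<lambda>\<omega> j. T j \<omega>)" and ?D = "distr P ?M (\<lambda>\<omega> j. D j \<omega>)"
  interpret PT: prob_space ?T by (rule prob_space_distr) measurable
  interpret PD: prob_space ?D by (rule prob_space_distr) measurable
  interpret TD: pair_sigma_finite ?T ?D ..
  note [measurable] = H
  have [measurable]: "(\<lambda>d. d k) \<in> ?M \<rightarrow>\<^sub>M Rn n" by (rule measurable_component_singleton) simp
  have G [measurable]: "(\<lambda>d. \<integral>\<^sup>+ t. H (t, d) \<partial>?T) \<in> borel_measurable (Rn n)" by measurable
  have "(\<integral>\<^sup>+ \<omega>. H (\<lambda>j. T j \<omega>, D k \<omega>) \<partial>P)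
      = (\<integral>\<^sup>+ x. H (fst x, snd x k) \<partial>distr P (?M \<Otimes>\<^sub>M ?M) (\<lambda>\<omega>. (\<lambda>j. T j \<omega>, \<lambda>j. D j \<omega>)))"
    by (subst nn_integral_distr) auto
  also have "distr P (?M \<Otimes>\<^sub>M ?M) (\<lambda>\<omega>. (\<lambda>j. T j \<omega>, \<lambda>j. D j \<omega>)) = ?T \<Otimes>\<^sub>M ?D"
    using indep_marks unfolding indep_var_distribution_eq by simp
  also have "(\<integral>\<^sup>+ x. H (fst x, snd x k) \<partial>(?T \<Otimes>\<^sub>M ?D)) = (\<integral>\<^sup>+ d. \<integral>\<^sup>+ t. H (t, d k) \<partial>?T \<partial>?D)"
    by (subst TD.nn_integral_snd[symmetric]) auto
  also have "\<dots> = (\<integral>\<^sup>+ \<omega>. \<integral>\<^sup>+ t. H (t, D k \<omega>) \<partial>?T \<partial>P)"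
    by (rule nn_integral_distr) measurable
  also have "\<dots> = (\<integral>\<^sup>+ d. \<integral>\<^sup>+ t. H (t, d) \<partial>?T \<partial>distr P (Rn n) (D k))"
    by (rule nn_integral_distr[symmetric]) measurable
  also have "\<dots> = (\<integral>\<^sup>+ d. \<integral>\<^sup>+ \<omega>. H (\<lambda>j. T j \<omega>, d) \<partial>P \<partial>Q)"
    unfolding distr_D
  proof (rule nn_integral_cong)
    fix d assume "d \<in> space Q"
    then have [measurable]: "d \<in> space (Rn n)" using sets_eq_imp_space_eq[OF sets_Q] by simp
    show "(\<integral>\<^sup>+ t. H (t, d) \<partial>?T) = (\<integral>\<^sup>+ \<omega>. H (\<lambda>j. T j \<omega>, d) \<partial>P)"
      by (rule nn_integral_distr) measurable
  qed
  finally show ?thesis .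
qed

lemma AE_density_pos: "AE \<omega> in P. f (D k \<omega>) > 0"
proof -
  have "AE x in Q. f x > 0"
    unfolding Q_def by (subst AE_density) auto
  then have "AE x in distr P (Rn n) (D k). f x > 0" by (simp only: distr_D)
  then show ?thesis by (subst (asm) AE_distr_iff) auto
qed

text \<open>Triples of noise \<open>d\<close>, sent point \<open>x\<close> and rival
  \<open>y\<close>. Decoding takes place in the configuration seen from \<open>x\<close>, where the
  rival sits at \<open>y - x\<close>.\<close>

definition confusable :: "((nat \<Rightarrow> real) \<times> (nat \<Rightarrow> real) \<times> (nat \<Rightarrow> real)) set" where
  "confusable = {(d, x, y) \<in> space (Rn n \<Otimes>\<^sub>M Rn n \<Otimes>\<^sub>M Rn n). vdiff n d (vdiff n y x) \<in> superlevel n f d}"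

lemma confusable_measurable [measurable]: "confusable \<in> sets (Rn n \<Otimes>\<^sub>M Rn n \<Otimes>\<^sub>M Rn n)"
proof -
  have "confusable = {z \<in> space (Rn n \<Otimes>\<^sub>M Rn n \<Otimes>\<^sub>M Rn n).
      exp (- 1) * f (fst z) \<le> f (vdiff n (fst z) (vdiff n (snd (snd z)) (fst (snd z))))}"
    by (auto simp: confusable_def superlevel_def)
  then show ?thesis by simp
qed

lemma superlevel_measurable [measurable]: "superlevel n f d \<in> sets (Rn n)"
  unfolding superlevel_def by measurable

lemma unit_cube_measurable [measurable]: "unit_cube n \<in> sets (Rn n)"
  by (simp add: unit_cube_def)

lemma emeasure_unit_cube: "emeasure (Rn n) (unit_cube n) = 1"
  unfolding unit_cube_def by (subst emeasure_Rn_PiE) auto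

text \<open>For each \<open>x\<close> in the cube the section is a reflected superlevel set of
  unchanged volume, and the cube has volume 1.\<close>

lemma emeasure_confusable:
  assumes d: "d \<in> space (Rn n)"
  shows "emeasure (Rn n \<Otimes>\<^sub>M Rn n) {z \<in> space (Rn n \<Otimes>\<^sub>M Rn n). fst z \<in> unit_cube n \<and> (d, z) \<in> confusable}
    = emeasure (Rn n) (superlevel n f d)" (is "emeasure _ ?S = _")
proof -
  interpret sigma_finite_measure "Rn n" by (rule sigma_finite_Rn)
  note [measurable] = d
  have "emeasure (Rn n \<Otimes>\<^sub>M Rn n) ?S = (\<integral>\<^sup>+ x. emeasure (Rn n) (Pair x -` ?S) \<partial>Rn n)"
    by (rule emeasure_pair_measure_alt) measurable
  also have "\<dots> = (\<integral>\<^sup>+ x. emeasure (Rn n) (superlevel n f d) * indicator (unit_cube n) x \<partial>Rn n)"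
  proof (rule nn_integral_cong)
    fix x assume x: "x \<in> space (Rn n)"
    have "Pair x -` ?S = (if x \<in> unit_cube n
        then {y \<in> space (Rn n). vdiff n (\<lambda>i. d i + x i) y \<in> superlevel n f d} else {})"
      using x d by (auto simp: confusable_def space_pair_measure vdiff_vdiff)
    then show "emeasure (Rn n) (Pair x -` ?S) = emeasure (Rn n) (superlevel n f d) * indicator (unit_cube n) x"
      by (simp add: emeasure_reflection)
  qed
  also have "\<dots> = emeasure (Rn n) (superlevel n f d)"
    by (subst nn_integral_cmult_indicator) (auto simp: emeasure_unit_cube)
  finally show ?thesis .
qed

text \<open>A measurable majorant of the \<open>k\<close>-th summand of the Palm integral: the
  number of rivals, truncated at 1. The error event is a family of configurations that carries no
  sigma-algebra, so it is replaced before integrals and sums are exchanged.\<close>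

definition hit :: "nat \<Rightarrow> (nat \<Rightarrow> nat \<Rightarrow> real) \<times> (nat \<Rightarrow> real) \<Rightarrow> ennreal" where
  "hit k = (\<lambda>(t, d). indicator (unit_cube n) (t k)
     * min 1 (\<Sum>j. if j = k then 0 else indicator confusable (d, t k, t j)))"

lemma hit_measurable [measurable]:
  "hit k \<in> borel_measurable (Pi\<^sub>M UNIV (\<lambda>_. Rn n) \<Otimes>\<^sub>M Rn n)"
proof -
  have [measurable]: "(\<lambda>x. fst x j) \<in> Pi\<^sub>M UNIV (\<lambda>_. Rn n) \<Otimes>\<^sub>M Rn n \<rightarrow>\<^sub>M Rn n" for j :: nat
    by (rule measurable_compose[OF measurable_fst measurable_component_singleton]) simp
  show ?thesis unfolding hit_def case_prod_beta by measurable
qed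

text \<open>Where the origin is a strict minimizer decoding is correct, so an error yields a rival
  in the superlevel set. Distinctness of the points ensures that the mark found at the origin is
  that of index \<open>k\<close>.\<close>

lemma indicator_error_le_hit:
  assumes \<omega>: "\<omega> \<in> space P" and distinct: "\<forall>k j. k \<noteq> j \<longrightarrow> T k \<omega> \<noteq> T j \<omega>" and pos: "f (D k \<omega>) > 0"
  shows "indicator (unit_cube n) (T k \<omega>) * indicator (error_event n f) (seen_from n T D k \<omega>)
    \<le> hit k (\<lambda>j. T j \<omega>, D k \<omega>)"
proof (cases "T k \<omega> \<in> unit_cube n \<and> seen_from n T D k \<omega> \<in> error_event n f")
  case True
  have sp: "T j \<omega> \<in> space (Rn n)" "D j \<omega> \<in> space (Rn n)" for j
    using measurable_space[OF T_measurable \<omega>] measurable_space[OF D_measurable \<omega>] by auto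
  let ?\<Phi> = "fst ` seen_from n T D k \<omega>"
  obtain j where j: "vdiff n (T j \<omega>) (T k \<omega>) = vorigin n" "D j \<omega> \<notin> decoding_region n f ?\<Phi> (vorigin n)"
    using True by (auto simp: error_event_def seen_from_def)
  then have "j = k" using distinct sp by (auto simp: vdiff_eq_vorigin_iff)
  then have "\<not> strict_minimizer n f ?\<Phi> (D k \<omega>) (vorigin n)"
    using j(2) sp by (auto simp: decoding_region_def)
  then obtain s where s: "s \<in> ?\<Phi>" "s \<noteq> vorigin n" "vdiff n (D k \<omega>) s \<in> superlevel n f (D k \<omega>)"
    by (rule not_strict_minimizer_origin[where f = f and d = "D k \<omega>", OF sp(2) pos n])
  then obtain i where i: "s = vdiff n (T i \<omega>) (T k \<omega>)" by (auto simp: seen_from_def)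
  then have "i \<noteq> k" using s(2) sp by (auto simp: vdiff_eq_vorigin_iff)
  moreover have "(D k \<omega>, T k \<omega>, T i \<omega>) \<in> confusable"
    using s(3) i sp by (auto simp: confusable_def space_pair_measure)
  ultimately have "1 \<le> (\<Sum>j\<in>{i}. if j = k then 0 else indicator confusable (D k \<omega>, T k \<omega>, T j \<omega>) :: ennreal)"
    by simp
  also have "\<dots> \<le> (\<Sum>j. if j = k then 0 else indicator confusable (D k \<omega>, T k \<omega>, T j \<omega>))"
    by (rule sum_le_suminf) auto
  finally show ?thesis using True by (simp add: hit_def min_absorb1)
qed auto

text \<open>Bounding the truncated count by 1 leaves the intensity \<open>lam\<close>; bounding it
  by the untruncated sum leaves the second factorial moment measure, hence \<open>lam\<close>
  squared times a volume.\<close>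

lemma sum_hit_le:
  assumes d: "d \<in> space (Rn n)"
  shows "(\<integral>\<^sup>+ \<omega>. (\<Sum>k. hit k (\<lambda>j. T j \<omega>, d)) \<partial>P)
    \<le> ennreal lam * min 1 (ennreal lam * emeasure (Rn n) (superlevel n f d))"
proof -
  let ?S = "{z \<in> space (Rn n \<Otimes>\<^sub>M Rn n). fst z \<in> unit_cube n \<and> (d, z) \<in> confusable}"
  note [measurable] = d
  have "(\<integral>\<^sup>+ \<omega>. (\<Sum>k. hit k (\<lambda>j. T j \<omega>, d)) \<partial>P) \<le> (\<integral>\<^sup>+ \<omega>. (\<Sum>k. indicator (unit_cube n) (T k \<omega>)) \<partial>P)"
    by (intro nn_integral_mono suminf_le) (auto simp: hit_def split: split_indicator)
  also have "\<dots> = ennreal lam" using intensity_eq by (simp add: intensity_def)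
  finally have 1: "(\<integral>\<^sup>+ \<omega>. (\<Sum>k. hit k (\<lambda>j. T j \<omega>, d)) \<partial>P) \<le> ennreal lam" .
  have "(\<integral>\<^sup>+ \<omega>. (\<Sum>k. hit k (\<lambda>j. T j \<omega>, d)) \<partial>P)
      \<le> (\<integral>\<^sup>+ \<omega>. (\<Sum>k. \<Sum>j. if j = k then 0 else indicator ?S (T k \<omega>, T j \<omega>)) \<partial>P)"
  proof (intro nn_integral_mono suminf_le)
    fix \<omega> k assume "\<omega> \<in> space P"
    then have sp: "T j \<omega> \<in> space (Rn n)" for j using measurable_space[OF T_measurable] by auto
    have "hit k (\<lambda>j. T j \<omega>, d)
        \<le> indicator (unit_cube n) (T k \<omega>) * (\<Sum>j. if j = k then 0 else indicator confusable (d, T k \<omega>, T j \<omega>))"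
      unfolding hit_def by (auto intro: mult_left_mono)
    also have "\<dots> = (\<Sum>j. indicator (unit_cube n) (T k \<omega>) * (if j = k then 0 else indicator confusable (d, T k \<omega>, T j \<omega>)))"
      by (rule ennreal_suminf_cmult[symmetric])
    also have "\<dots> = (\<Sum>j. if j = k then 0 else indicator ?S (T k \<omega>, T j \<omega>))"
      using sp by (intro suminf_cong) (auto simp: space_pair_measure split: split_indicator)
    finally show "hit k (\<lambda>j. T j \<omega>, d) \<le> (\<Sum>j. if j = k then 0 else indicator ?S (T k \<omega>, T j \<omega>))" .
  qed auto
  also have "\<dots> = emeasure pair_intensity ?S"
    by (subst emeasure_pair_intensity) (simp_all add: nn_integral_count_space_off_diagonal cong: if_cong)
  also have "\<dots> = (ennreal lam)\<^sup>2 * emeasure (Rn n) (superlevel n f d)"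
    by (subst pair_intensity_eq) (auto simp: emeasure_confusable[OF d])
  finally have 2: "(\<integral>\<^sup>+ \<omega>. (\<Sum>k. hit k (\<lambda>j. T j \<omega>, d)) \<partial>P)
      \<le> (ennreal lam)\<^sup>2 * emeasure (Rn n) (superlevel n f d)" .
  from 1 2 show ?thesis
    by (auto simp: min_def power2_eq_square mult.assoc)
qed

text \<open>\<open>sum_hit_le\<close> is averaged over the mark, and its factor \<open>lam\<close>
  cancels against the intensity that normalises the Palm probability.\<close>

lemma error_prob_le:
  "error_prob P n f T D \<le> (\<integral>\<^sup>+ d. min 1 (ennreal lam * emeasure (Rn n) (superlevel n f d)) \<partial>Q)"
proof -
  interpret R: sigma_finite_measure "Rn n" by (rule sigma_finite_Rn)
  \<comment> \<open>The volume is written as the section integral of a jointly measurable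
    set.\<close>
  have [measurable]: "(\<lambda>d. emeasure (Rn n) (superlevel n f d)) \<in> borel_measurable (Rn n)"
  proof -
    have "(\<lambda>d. \<integral>\<^sup>+ z. indicator {x \<in> space (Rn n \<Otimes>\<^sub>M Rn n). exp (- 1) * f (fst x) \<le> f (snd x)} (d, z) \<partial>Rn n)
        \<in> borel_measurable (Rn n)" by measurable
    also have "?this \<longleftrightarrow> ?thesis"
    proof (rule measurable_cong)
      fix d assume "d \<in> space (Rn n)"
      then have "(\<integral>\<^sup>+ z. indicator {x \<in> space (Rn n \<Otimes>\<^sub>M Rn n). exp (- 1) * f (fst x) \<le> f (snd x)} (d, z) \<partial>Rn n)
        = (\<integral>\<^sup>+ z. indicator (superlevel n f d) z \<partial>Rn n)"
        by (intro nn_integral_cong) (auto simp: superlevel_def space_pair_measure split: split_indicator)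
      then show "(\<integral>\<^sup>+ z. indicator {x \<in> space (Rn n \<Otimes>\<^sub>M Rn n). exp (- 1) * f (fst x) \<le> f (snd x)} (d, z) \<partial>Rn n)
        = emeasure (Rn n) (superlevel n f d)" by (simp add: nn_integral_indicator)
    qed
    finally show ?thesis .
  qed
  have "AE \<omega> in P. \<forall>k. f (D k \<omega>) > 0" using AE_density_pos by (simp add: AE_all_countable)
  then have "(\<integral>\<^sup>+ \<omega>. (\<Sum>k. indicator (unit_cube n) (T k \<omega>) * indicator (error_event n f) (seen_from n T D k \<omega>)) \<partial>P)
      \<le> (\<integral>\<^sup>+ \<omega>. (\<Sum>k. hit k (\<lambda>j. T j \<omega>, D k \<omega>)) \<partial>P)"
    \<comment> \<open>Monotonicity of the integral does not ask for measurability of the left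
      integrand.\<close>
    using AE_distinct_points AE_space
    by (intro nn_integral_mono_AE, eventually_elim, intro suminf_le indicator_error_le_hit) auto
  also have "\<dots> = (\<Sum>k. \<integral>\<^sup>+ \<omega>. hit k (\<lambda>j. T j \<omega>, D k \<omega>) \<partial>P)"
    by (rule nn_integral_suminf) measurable
  also have "\<dots> = (\<Sum>k. \<integral>\<^sup>+ d. \<integral>\<^sup>+ \<omega>. hit k (\<lambda>j. T j \<omega>, d) \<partial>P \<partial>Q)"
    by (intro suminf_cong nn_integral_point_mark) measurable
  also have "\<dots> = (\<integral>\<^sup>+ d. (\<Sum>k. \<integral>\<^sup>+ \<omega>. hit k (\<lambda>j. T j \<omega>, d) \<partial>P) \<partial>Q)"
    by (rule nn_integral_suminf[symmetric]) measurable
  also have "\<dots> \<le> (\<integral>\<^sup>+ d. ennreal lam * min 1 (ennreal lam * emeasure (Rn n) (superlevel n f d)) \<partial>Q)"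
  proof (rule nn_integral_mono)
    fix d assume "d \<in> space Q"
    then have d: "d \<in> space (Rn n)" using sets_eq_imp_space_eq[OF sets_Q] by simp
    note [measurable] = d
    have "(\<Sum>k. \<integral>\<^sup>+ \<omega>. hit k (\<lambda>j. T j \<omega>, d) \<partial>P) = (\<integral>\<^sup>+ \<omega>. (\<Sum>k. hit k (\<lambda>j. T j \<omega>, d)) \<partial>P)"
      by (rule nn_integral_suminf[symmetric]) measurable
    then show "(\<Sum>k. \<integral>\<^sup>+ \<omega>. hit k (\<lambda>j. T j \<omega>, d) \<partial>P)
      \<le> ennreal lam * min 1 (ennreal lam * emeasure (Rn n) (superlevel n f d))"
      using sum_hit_le[OF d] by simp
  qed
  also have "\<dots> = ennreal lam * (\<integral>\<^sup>+ d. min 1 (ennreal lam * emeasure (Rn n) (superlevel n f d)) \<partial>Q)"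
    by (rule nn_integral_cmult) measurable
  finally have "error_prob P n f T D
      \<le> (ennreal lam * (\<integral>\<^sup>+ d. min 1 (ennreal lam * emeasure (Rn n) (superlevel n f d)) \<partial>Q)) / ennreal lam"
    unfolding error_prob_def palm_prob_def intensity_eq by (rule divide_right_mono_ennreal)
  also have "\<dots> = (\<integral>\<^sup>+ d. min 1 (ennreal lam * emeasure (Rn n) (superlevel n f d)) \<partial>Q)"
    using lam by (simp add: ennreal_mult_divide_eq mult.commute[of "ennreal lam"])
  finally show ?thesis .
qed

end


text \<open>On the superlevel set \<open>f\<close> is positive, so Lebesgue measure is recovered
  from the noise law by the weight \<open>1 / f x = exp (n * t)\<close> with
  \<open>t = - ln (f x) / n\<close>. The factor \<open>exp (- 1)\<close> becomes the shift by
  \<open>1 / n\<close>.\<close>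

lemma emeasure_superlevel_le:
  assumes [measurable]: "f \<in> borel_measurable (Rn n)" and d: "f d > 0" and n: "n \<ge> 1"
  shows "emeasure (Rn n) (superlevel n f d) \<le>
    (\<integral>\<^sup>+ t\<in>{..- ln (f d) / real n + 1 / real n}. ennreal (exp (real n * t))
      \<partial>distr (density (Rn n) (\<lambda>x. ennreal (f x))) borel (\<lambda>x. - ln (f x) / real n))"
proof -
  let ?w = "- ln (f d) / real n + 1 / real n"
  have [measurable]: "superlevel n f d \<in> sets (Rn n)" unfolding superlevel_def by measurable
  have "emeasure (Rn n) (superlevel n f d) = (\<integral>\<^sup>+ x. indicator (superlevel n f d) x \<partial>Rn n)"
    by (simp add: nn_integral_indicator)
  also have "\<dots> \<le> (\<integral>\<^sup>+ x. ennreal (f x) * (ennreal (exp (real n * (- ln (f x) / real n)))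
      * indicator {..?w} (- ln (f x) / real n)) \<partial>Rn n)"
  proof (rule nn_integral_mono)
    fix x
    show "indicator (superlevel n f d) x \<le> ennreal (f x) * (ennreal (exp (real n * (- ln (f x) / real n)))
      * indicator {..?w} (- ln (f x) / real n))"
    proof (cases "x \<in> superlevel n f d")
      case True
      then have le: "exp (- 1) * f d \<le> f x" by (simp add: superlevel_def)
      moreover have "0 < exp (- 1) * f d" using d by simp
      ultimately have pos: "f x > 0" by linarith
      have "ln (exp (- 1) * f d) \<le> ln (f x)" using le d by (intro ln_mono) auto
      then have "- 1 + ln (f d) \<le> ln (f x)" using d by (simp add: ln_mult)
      then have "- ln (f x) / real n \<le> ?w" using n by (simp add: field_simps)
      moreover have "ennreal (f x) * ennreal (exp (real n * (- ln (f x) / real n))) = 1"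
        using pos n by (simp add: ennreal_mult[symmetric] exp_minus)
      ultimately show ?thesis using True by simp
    qed simp
  qed
  also have "\<dots> = (\<integral>\<^sup>+ x. ennreal (exp (real n * (- ln (f x) / real n)))
      * indicator {..?w} (- ln (f x) / real n) \<partial>density (Rn n) (\<lambda>x. ennreal (f x)))"
    by (rule nn_integral_density[symmetric]) measurable
  also have "\<dots> = (\<integral>\<^sup>+ t\<in>{..?w}. ennreal (exp (real n * t))
      \<partial>distr (density (Rn n) (\<lambda>x. ennreal (f x))) borel (\<lambda>x. - ln (f x) / real n))"
    by (rule nn_integral_distr[symmetric]) measurable
  finally show ?thesis .
qed

theorem mainTheorem3:
  fixes N :: "'v measure" and X :: "nat \<Rightarrow> 'v \<Rightarrow> real"
    and f :: "nat \<Rightarrow> (nat \<Rightarrow> real) \<Rightarrow> real"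
    and h \<alpha> :: real and I :: "real \<Rightarrow> ereal"
    and P :: "nat \<Rightarrow> 'w measure"
    and T D :: "nat \<Rightarrow> nat \<Rightarrow> 'w \<Rightarrow> (nat \<Rightarrow> real)"
  assumes "prob_space N"
    and "\<And>l. l \<ge> 1 \<Longrightarrow> X l \<in> borel_measurable N"
    and "centered_process N X" and "stationary_process N X" and "ergodic_process N X"
    and density: "\<And>n. n \<ge> 1 \<Longrightarrow> has_density N X n (f n)"
    and entropy: "\<And>n. n \<ge> 1 \<Longrightarrow> diff_entropy_well_defined n (f n)"
    and entropy_rate: "(\<lambda>n. diff_entropy n (f n) / ereal (real n)) \<longlonglongrightarrow> ereal h"
    and LDP: "LDP (info_law N X f) I" "good_rate_function I" "convex_ereal I"
    and "\<alpha> > 1"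
    and "\<And>n. n \<ge> 1 \<Longrightarrow> prob_space (P n)"
    and Poisson: "\<And>n. n \<ge> 1 \<Longrightarrow>
          homogeneous_Poisson (P n) n (exp (real n * (- h - ln \<alpha>))) (T n)"
    and marks: "\<And>n. n \<ge> 1 \<Longrightarrow> iid_marks (P n) n (distr N (Rn n) (noise_vec X n)) (T n) (D n)"
  shows "error_exponent (\<lambda>n. error_prob (P n) n (f n) (T n) (D n)) \<ge>
           (INF u. F_fun \<alpha> h I u + I u)"
proof -
  interpret N: prob_space N by fact
  let ?\<rho> = "info_law N X f" and ?L = "ln \<alpha> + h"
  have noise: "noise_vec X n \<in> N \<rightarrow>\<^sub>M Rn n" and f [measurable]: "f n \<in> borel_measurable (Rn n)"
    and law: "distr N (Rn n) (noise_vec X n) = density (Rn n) (\<lambda>x. ennreal (f n x))" if "n \<ge> 1" for n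
    using density[OF that] by (auto simp: has_density_def distributed_def)
  have info: "(\<lambda>\<omega>. - ln (f n (noise_vec X n \<omega>)) / real n) \<in> borel_measurable N" for n
  proof (cases "n \<ge> 1")
    case True
    note [measurable] = noise[OF True] f[OF True]
    show ?thesis by measurable
  \<comment> \<open>In dimension 0, division by \<open>real 0\<close> gives the constant 0.\<close>
  qed (simp add: not_le)
  have sets_info: "sets (?\<rho> n) = sets borel" for n by (simp add: info_law_def)
  have prob_info: "prob_space (?\<rho> n)" for n
    unfolding info_law_def by (rule N.prob_space_distr[OF info])
  have "error_prob (P n) n (f n) (T n) (D n) \<le> (\<integral>\<^sup>+ s. min 1 (ennreal (exp (- (real n * ?L)))
      * (\<integral>\<^sup>+ t\<in>{..s + 1 / real n}. ennreal (exp (real n * t)) \<partial>?\<rho> n)) \<partial>?\<rho> n)" if n: "n \<ge> 1" for n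
  proof -
    let ?lam = "exp (real n * (- h - ln \<alpha>))" and ?Q = "density (Rn n) (\<lambda>x. ennreal (f n x))"
    let ?\<phi> = "\<lambda>x. - ln (f n x) / real n"
    \<comment> \<open>The intensity in the form that \<open>error_exponent_bound\<close> expects,
      with \<open>L = ln \<alpha> + h\<close>.\<close>
    have lam_eq: "?lam = exp (- (real n * ?L))" by (simp add: algebra_simps)
    note [measurable] = noise[OF n] f[OF n]
    interpret marked_Poisson_points "P n" n ?lam "T n" "D n" "f n" ?Q
      using assms(13)[OF n] Poisson[OF n] marks[OF n] n law[OF n]
      by (intro marked_Poisson_points.intro Poisson_points.intro Poisson_points_axioms.intro
          marked_Poisson_points_axioms.intro) auto
    have rho: "?\<rho> n = distr ?Q borel ?\<phi>"
      unfolding info_law_def law[OF n, symmetric] by (subst distr_distr) (auto simp: comp_def)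
    let ?V = "\<lambda>w. \<integral>\<^sup>+ t\<in>{..w}. ennreal (exp (real n * t)) \<partial>?\<rho> n"
    have "?V \<in> borel_measurable borel"
      using prob_info[of n] by (intro measurable_nn_integral_atMost sets_info) (auto simp: prob_space_def)
    then have G [measurable]: "(\<lambda>s. min 1 (ennreal ?lam * ?V (s + 1 / real n))) \<in> borel_measurable borel"
      by measurable
    \<comment> \<open>The volume bound needs a positive density at the noise, which holds almost
      surely under the law with that density.\<close>
    have "AE x in ?Q. f n x > 0" by (subst AE_density) auto
    then have "(\<integral>\<^sup>+ d. min 1 (ennreal ?lam * emeasure (Rn n) (superlevel n (f n) d)) \<partial>?Q)
        \<le> (\<integral>\<^sup>+ d. min 1 (ennreal ?lam * ?V (?\<phi> d + 1 / real n)) \<partial>?Q)"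
    proof (intro nn_integral_mono_AE, eventually_elim)
      case (elim d)
      show ?case
        unfolding rho using elim n by (intro min.mono mult_left_mono emeasure_superlevel_le) auto
    qed
    also have "\<dots> = (\<integral>\<^sup>+ s. min 1 (ennreal ?lam * ?V (s + 1 / real n)) \<partial>distr ?Q borel ?\<phi>)"
      by (rule nn_integral_distr[symmetric]) measurable
    finally show ?thesis using error_prob_le unfolding rho[symmetric] lam_eq by order
  qed
  then have "(INF u. max (ereal ?L - J_fun I u) 0 + I u)
      \<le> error_exponent (\<lambda>n. error_prob (P n) n (f n) (T n) (D n))"
    using prob_info by (intro error_exponent_bound[OF LDP(1,2) sets_info]) (auto simp: prob_space.emeasure_space_1)
  then show ?thesis by (simp add: F_fun_def)
qed

end
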